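(* Let $\{A(k)\mid k\geq 1\}$ be a sequence of independent and identically distributed random $n\times n$ matrices over the max-plus semiring $\mathbb{R}_{\max,+}$ with $\mathsf{E}\|A(1)\|<\infty$ and $\rho(\mathsf{E}A(1))>-\infty$. Suppose that $A(k)$ allows for a backward triangular skeleton decomposition $$A(k)=B(k)C(k),\qquad k=1,2,\ldots,$$ with independent factors $B(k)$ and $C(k)$, the pairs $(B(k),C(k))$ being independent and identically distributed for $k=1,2,\ldots$. Then the Lyapunov exponent $$\lambda=\lim_{k\to\infty}\|A_{k}\|^{1/k},\qquad A_k=A(1)A(2)\cdots A(k),$$ is given by $$\lambda=\operatorname{tr}\bigl(\mathsf{E}[C(1)B(1)]\bigr).$$
   Context: The max-plus semiring is $\mathbb{R}_{\max,+}=(\mathbb{R}\cup\{-\infty\},\oplus,\otimes)$ with $x\oplus y=\max(x,y)$, $x\otimes y=x+y$, zero element $\mathbb{0}=-\infty$ and identity $\mathbb{1}=0$. The sign $\otimes$ is omitted. The power $x^{y}$ is the ordinary product $xy$; in particular $x^{1/k}$ is $x/k$ in ordinary arithmetic. Matrix sums and products are defined by the usual formulas with $\oplus,\otimes$, so $\{BC\}_{ij}=\max_{l}(\{B\}_{il}+\{C\}_{lj})$. A nonzero matrix (one not having all entries $-\infty$) is always assumed regular, i.e. each of its rows has at least one entry different from $-\infty$. A square matrix is triangular if all its entries above the diagonal, or all its entries below the diagonal, are $-\infty$. Norm, for a matrix of any size: $\|A\|=\max_{i,j}a_{ij}$. Trace, for a square matrix: $\operatorname{tr}A=\bigoplus_i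 a_{ii}=\max_i a_{ii}$. Spectral radius of an $n\times n$ matrix: $\rho(A)=\bigoplus_{m=1}^{n}\operatorname{tr}^{1/m}(A^{m})$, i.e. $\rho(A)=\max_{1\le m\le n}\frac1m\operatorname{tr}(A^m)$ in ordinary arithmetic, where $A^m$ is the max-plus matrix power. A vector $y$ is linearly dependent on $x_1,\ldots,x_m$ if $y=a_1x_1\oplus\cdots\oplus a_mx_m$ for some scalars $a_i\in\mathbb{R}\cup\{-\infty\}$. The rank of a matrix is its maximum number of linearly independent rows (columns). A skeleton decomposition of an $n\times n$ matrix $A$ with $r=\operatorname{rank}A<n$ is a factorization $A=BC$ with $B$ of size $n\times r$ and $C$ of size $r\times n$. It is called backward triangular if the $r\times r$ matrix $CB$ is triangular. For the random matrices $A(k)$, the number $r$ is the same for all $k$. All random variables are defined on a common probability space. Each entry of a random matrix (including $A(k)$, $B(k)$, $C(k)$) is either identically $-\infty$ or a real-valued random variable with finite mean, and the positions of the entries identically equal to $-\infty$ do not depend on $k$. For a random matrix $A$, $\mathsf{E}A$ denotes the matrix obtained by replacing each entry by its expected value, with the convention $\mathsf{E}(-\infty)=-\infty$; thus $\mathsf{E}[C(1)B(1)]$ is the entrywise mean of the max-plus product $C(1)B(1)$. The entries within a single matrix need not be independent. Under these assumptions the limit defining $\lambda$ exists with probability $1$ and is a finite constant, and also $\lambda=\lim_{k\to\infty}\frac1k\mathsf{E}\|A_k\|$. *)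

theory Defs
  imports "HOL-Probability.Probability"
begin

text \<open>
  The max-plus semiring lives inside \<^typ>\<open>ereal\<close> as the elements other than \<open>\<infinity>\<close>: its zero
  is \<open>-\<infinity>\<close>, its unit is \<open>0\<close>, its sum is the maximum and its product is \<open>+\<close>. Finite max-plus
  sums are written with \<open>SUP\<close>, which is the maximum on nonempty finite index sets and \<open>-\<infinity>\<close>
  (the max-plus zero) on the empty one. An \<open>n \<times> r\<close> matrix has type \<open>ereal^'r^'n\<close>.
\<close>

definition mp_powr :: "ereal \<Rightarrow> real \<Rightarrow> ereal" where
  "mp_powr x y = x * ereal y"

definition mp_mult :: "ereal^'m^'n \<Rightarrow> ereal^'k^'m \<Rightarrow> ereal^'k^'n" (infixl \<open>\<otimes>\<^sub>m\<close> 70) where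
  "B \<otimes>\<^sub>m C = (\<chi> i j. SUP l. B $ i $ l + C $ l $ j)"

definition mp_one :: "ereal^'n^'n" where
  "mp_one = (\<chi> i j. if i = j then 0 else -\<infinity>)"

primrec mp_power :: "ereal^'n^'n \<Rightarrow> nat \<Rightarrow> ereal^'n^'n" where
  "mp_power A 0 = mp_one"
| "mp_power A (Suc m) = mp_power A m \<otimes>\<^sub>m A"

text \<open>The product \<open>X 1 \<otimes>\<^sub>m \<dots> \<otimes>\<^sub>m X k\<close>; the entry \<open>X 0\<close> is not used.\<close>

primrec mp_prod :: "(nat \<Rightarrow> ereal^'n^'n) \<Rightarrow> nat \<Rightarrow> ereal^'n^'n" where
  "mp_prod X 0 = mp_one"
| "mp_prod X (Suc k) = mp_prod X k \<otimes>\<^sub>m X (Suc k)"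

definition mp_norm :: "ereal^'m^'n \<Rightarrow> ereal" where
  "mp_norm A = (SUP i. SUP j. A $ i $ j)"

definition mp_trace :: "ereal^'n^'n \<Rightarrow> ereal" where
  "mp_trace A = (SUP i. A $ i $ i)"

definition mp_spectral_radius :: "ereal^'n^'n \<Rightarrow> ereal" where
  "mp_spectral_radius A =
    (SUP m\<in>{1..CARD('n)}. mp_powr (mp_trace (mp_power A m)) (1 / real m))"

definition mp_regular :: "ereal^'m^'n \<Rightarrow> bool" where
  "mp_regular A \<longleftrightarrow> (\<forall>i. \<exists>j. A $ i $ j \<noteq> -\<infinity>)"

definition mp_triangular :: "ereal^('r::{finite,linorder})^('r::{finite,linorder}) \<Rightarrow> bool" where
  "mp_triangular A \<longleftrightarrow>
    (\<forall>i j. i < j \<longrightarrow> A $ i $ j = -\<infinity>) \<or> (\<forall>i j. j < i \<longrightarrow> A $ i $ j = -\<infinity>)"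

definition mp_dependent_on :: "ereal^'n \<Rightarrow> ('i \<Rightarrow> ereal^'n) \<Rightarrow> 'i set \<Rightarrow> bool" where
  "mp_dependent_on y x I \<longleftrightarrow>
    (\<exists>a. (\<forall>i\<in>I. a i \<noteq> \<infinity>) \<and> (\<forall>j. y $ j = (SUP i\<in>I. a i + x i $ j)))"

definition mp_independent :: "('i \<Rightarrow> ereal^'n) \<Rightarrow> 'i set \<Rightarrow> bool" where
  "mp_independent x I \<longleftrightarrow> (\<forall>i\<in>I. \<not> mp_dependent_on (x i) x (I - {i}))"

definition mp_row_rank :: "ereal^'m^'n \<Rightarrow> nat" where
  "mp_row_rank A = Max {card I |I. mp_independent (\<lambda>i. row i A) I}"

definition mp_col_rank :: "ereal^'m^'n \<Rightarrow> nat" where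
  "mp_col_rank A = Max {card J |J. mp_independent (\<lambda>j. column j A) J}"

text \<open>
  Over the max-plus semiring the row rank and the column rank of a matrix may differ. As rank is
  defined by rows or by columns interchangeably, the inner dimension may be either of the two.
\<close>

definition mp_skeleton_decomposition ::
    "ereal^'n^'n \<Rightarrow> ereal^'r^'n \<Rightarrow> ereal^'n^'r \<Rightarrow> bool" where
  "mp_skeleton_decomposition A B C \<longleftrightarrow>
    A = B \<otimes>\<^sub>m C \<and> CARD('r) < CARD('n) \<and>
    (CARD('r) = mp_row_rank A \<or> CARD('r) = mp_col_rank A)"

definition mp_backward_triangular ::
    "ereal^('r::{finite,linorder})^'n \<Rightarrow> ereal^'n^('r::{finite,linorder}) \<Rightarrow> bool" where
  "mp_backward_triangular B C \<longleftrightarrow> mp_triangular (C \<otimes>\<^sub>m B)"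

definition mp_random_variable :: "'a measure \<Rightarrow> ('a \<Rightarrow> ereal) \<Rightarrow> bool" where
  "mp_random_variable M X \<longleftrightarrow>
    (\<forall>\<omega>\<in>space M. X \<omega> = -\<infinity>) \<or>
    ((\<forall>\<omega>\<in>space M. \<bar>X \<omega>\<bar> \<noteq> \<infinity>) \<and> integrable M (\<lambda>\<omega>. real_of_ereal (X \<omega>)))"

definition mp_random_matrix :: "'a measure \<Rightarrow> ('a \<Rightarrow> ereal^'m^'n) \<Rightarrow> bool" where
  "mp_random_matrix M X \<longleftrightarrow>
    X \<in> borel_measurable M \<and>
    (\<forall>i j. mp_random_variable M (\<lambda>\<omega>. X \<omega> $ i $ j)) \<and>
    (\<forall>\<omega>\<in>space M. (\<exists>i j. X \<omega> $ i $ j \<noteq> -\<infinity>) \<longrightarrow> mp_regular (X \<omega>))"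

definition mp_random_matrix_sequence :: "'a measure \<Rightarrow> (nat \<Rightarrow> 'a \<Rightarrow> ereal^'m^'n) \<Rightarrow> bool" where
  "mp_random_matrix_sequence M X \<longleftrightarrow>
    (\<forall>k\<ge>1. mp_random_matrix M (X k)) \<and>
    (\<forall>k\<ge>1. \<forall>l\<ge>1. \<forall>i j. \<forall>\<omega>\<in>space M. X k \<omega> $ i $ j = -\<infinity> \<longleftrightarrow> X l \<omega> $ i $ j = -\<infinity>)"

text \<open>\<open>indep_var\<close> of the library requires both variables to have the same type of values.\<close>

definition independent_variables ::
    "'a measure \<Rightarrow> 'b measure \<Rightarrow> ('a \<Rightarrow> 'b) \<Rightarrow> 'c measure \<Rightarrow> ('a \<Rightarrow> 'c) \<Rightarrow> bool" where
  "independent_variables M N X N' Y \<longleftrightarrow>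
    X \<in> measurable M N \<and> Y \<in> measurable M N' \<and>
    prob_space.indep_set M
      {X -` S \<inter> space M |S. S \<in> sets N} {Y -` S \<inter> space M |S. S \<in> sets N'}"

definition iid_sequence :: "'a measure \<Rightarrow> 'b measure \<Rightarrow> (nat \<Rightarrow> 'a \<Rightarrow> 'b) \<Rightarrow> bool" where
  "iid_sequence M N X \<longleftrightarrow>
    prob_space.indep_vars M (\<lambda>_. N) X {1..} \<and> (\<forall>k\<ge>1. distr M N (X k) = distr M N (X 1))"

definition mp_expectation :: "'a measure \<Rightarrow> ('a \<Rightarrow> ereal) \<Rightarrow> ereal" where
  "mp_expectation M X =
    (if \<forall>\<omega>\<in>space M. X \<omega> = -\<infinity> then -\<infinity> else ereal (\<integral>\<omega>. real_of_ereal (X \<omega>) \<partial>M))"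

definition mp_expectation_matrix :: "'a measure \<Rightarrow> ('a \<Rightarrow> ereal^'m^'n) \<Rightarrow> ereal^'m^'n" where
  "mp_expectation_matrix M X = (\<chi> i j. mp_expectation M (\<lambda>\<omega>. X \<omega> $ i $ j))"

definition has_lyapunov_exponent ::
    "'a measure \<Rightarrow> (nat \<Rightarrow> 'a \<Rightarrow> ereal^'n^'n) \<Rightarrow> real \<Rightarrow> bool" where
  "has_lyapunov_exponent M A l \<longleftrightarrow>
    (AE \<omega> in M. (\<lambda>k. mp_powr (mp_norm (mp_prod (\<lambda>i. A i \<omega>) k)) (1 / real k)) \<longlonglongrightarrow> ereal l)"

end

theory Submission
  imports Defs
begin

text \<open>
  Regrouping the factors, \<open>A\<^sub>k\<^sub>+\<^sub>1 = B(1) T(0) \<cdots> T(k-1) C(k+1)\<close> with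
  \<open>T(i) = C(i+1) B(i+2)\<close>. The positions of the finite entries do not depend on chance, so all \<open>T(i)\<close>
  are triangular like \<open>C(1) B(1)\<close>, and by independence of \<open>B(1)\<close> and \<open>C(1)\<close> they are distributed like
  \<open>C(1) B(1)\<close>. By the law of large numbers the sum of the \<open>p\<close>-th diagonal entries of
  \<open>T(0), \<dots>, T(k-1)\<close> grows like \<open>k\<close> times their mean. This bounds the growth rate from below by the
  largest diagonal mean. In the other direction a path through a triangular matrix changes its index
  only boundedly often, every such change contributes \<open>o(k)\<close>, and in between only diagonal entries
  are collected. Since \<open>\<rho>(E A(1)) > -\<infinity>\<close>, the finite entries of \<open>B C\<close> and hence those of \<open>C B\<close> contain a
  cycle, which for a triangular matrix forces a finite diagonal entry.
\<close>

section \<open>A law of large numbers for functions of i.i.d. sequences\<close>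

definition left_shift :: "(nat \<Rightarrow> 'b) \<Rightarrow> nat \<Rightarrow> 'b" where
  "left_shift \<omega> = (\<lambda>j. \<omega> (Suc j))"

lemma funpow_shift: "(left_shift ^^ i) \<omega> = (\<lambda>j. \<omega> (i + j))"
  by (induction i) (auto simp: left_shift_def)

text \<open>Reindexing along the injective map \<open>Suc\<close> turns a product of copies of
  \<open>D\<close> into another such product.\<close>

lemma distr_PiM_shift:
  assumes "prob_space D"
  shows "distr (PiM UNIV (\<lambda>_::nat. D)) (PiM UNIV (\<lambda>_. D)) left_shift = PiM UNIV (\<lambda>_. D)"
  using distr_PiM_reindex[of UNIV "\<lambda>_. D" Suc UNIV] assms
  by (simp add: left_shift_def[abs_def] restrict_UNIV)

lemma measurable_shift: "left_shift \<in> measurable (PiM UNIV (\<lambda>_::nat. D)) (PiM UNIV (\<lambda>_. D))"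
  unfolding left_shift_def[abs_def]
  by (rule measurable_PiM_single') (auto simp: space_PiM)

text \<open>Jointly the coordinates form the identity map, whose law is the product measure, and
  each marginal law is \<open>D\<close>. Joint law and product of the marginals thus agree.\<close>

lemma indep_vars_PiM_coordinate:
  assumes "prob_space D"
  shows "prob_space.indep_vars (PiM UNIV (\<lambda>_. D)) (\<lambda>_. D) (\<lambda>i \<omega>. \<omega> i) (UNIV :: nat set)"
proof -
  interpret P: product_prob_space "\<lambda>_::nat. D" UNIV
    using assms by (simp add: product_prob_space_def product_sigma_finite_def
        product_prob_space_axioms_def prob_space_imp_sigma_finite)
  have "distr (PiM UNIV (\<lambda>_. D)) D (\<lambda>\<omega>. \<omega> i) = D" for i :: nat
    by (rule P.PiM_component) simp
  then show ?thesis
    by (subst P.P.indep_vars_iff_distr_eq_PiM) (auto simp: distr_id2 restrict_UNIV)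
qed

text \<open>Invariance passes to all iterates of the shift, so for every \<open>n\<close> the event
  is determined by the coordinates from \<open>n\<close> on. It is therefore a tail event of
  independent coordinates, and Kolmogorov's law applies.\<close>

lemma shift_invariant_0_1:
  assumes "prob_space D" and E: "E \<in> sets (PiM UNIV (\<lambda>_::nat. D))"
    and inv: "\<And>\<omega>. \<omega> \<in> space (PiM UNIV (\<lambda>_::nat. D)) \<Longrightarrow> \<omega> \<in> E \<longleftrightarrow> left_shift \<omega> \<in> E"
  shows "measure (PiM UNIV (\<lambda>_::nat. D)) E = 0 \<or> measure (PiM UNIV (\<lambda>_::nat. D)) E = 1"
proof -
  let ?P = "PiM UNIV (\<lambda>_::nat. D)"
  interpret P: prob_space ?P
    using assms(1) by (intro prob_space_PiM)
  define G where "G i = {(\<lambda>\<omega>. \<omega> i) -` S \<inter> space ?P | S. S \<in> sets D}" for i :: nat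
  define F where "F i = sigma_sets (space ?P) (G i)" for i :: nat
  have inv': "\<omega> \<in> E \<longleftrightarrow> (left_shift ^^ n) \<omega> \<in> E" if "\<omega> \<in> space ?P" for \<omega> n
    using that
  proof (induction n arbitrary: \<omega>)
    case (Suc n)
    then have "left_shift \<omega> \<in> space ?P"
      using measurable_space[OF measurable_shift] by blast
    with Suc show ?case
      by (simp add: funpow_swap1 inv)
  qed simp
  have GP: "G i \<subseteq> Pow (space ?P)" for i
    by (auto simp: G_def)
  have "E \<in> P.tail_events F"
    unfolding P.tail_events_def
  proof
    fix n :: nat
    \<comment> \<open>\<open>?N\<close> carries only the information in the coordinates from
      \<open>n\<close> on. The \<open>n\<close>-fold shift is measurable with respect to it, and
      \<open>E\<close> is its own preimage under that shift.\<close>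
    let ?N = "sigma (space ?P) (\<Union>(F ` {n..}))"
    have FP: "\<Union>(F ` {n..}) \<subseteq> Pow (space ?P)"
      unfolding F_def using sigma_sets_into_sp[OF GP] by blast
    have "(\<lambda>\<omega> j. \<omega> (n + j)) \<in> measurable ?N ?P"
    proof (rule measurable_PiM_single')
      fix j :: nat
      show "(\<lambda>\<omega>. \<omega> (n + j)) \<in> measurable ?N D"
      proof (rule measurableI)
        fix S assume S: "S \<in> sets D"
        have "(\<lambda>\<omega>. \<omega> (n + j)) -` S \<inter> space ?P \<in> F (n + j)"
          unfolding F_def G_def using S by (intro sigma_sets.Basic) auto
        then show "(\<lambda>\<omega>. \<omega> (n + j)) -` S \<inter> space ?N \<in> sets ?N"
          using FP by (auto intro!: sigma_sets.Basic bexI[of _ "n + j"])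
      qed (use FP in \<open>auto simp: space_PiM\<close>)
    qed (use FP in \<open>auto simp: space_PiM\<close>)
    from measurable_sets[OF this E]
    have "(\<lambda>\<omega> j. \<omega> (n + j)) -` E \<inter> space ?P \<in> sigma_sets (space ?P) (\<Union>(F ` {n..}))"
      using FP by simp
    moreover have "(\<lambda>\<omega> j. \<omega> (n + j)) -` E \<inter> space ?P = E"
      using inv'[of _ n] sets.sets_into_space[OF E] by (auto simp: funpow_shift)
    ultimately show "E \<in> sigma_sets (space ?P) (\<Union>(F ` {n..}))"
      by simp
  qed
  moreover have "P.indep_sets F UNIV"
    using indep_vars_PiM_coordinate[OF assms(1)] unfolding P.indep_vars_def F_def G_def by blast
  moreover have "sigma_algebra (space ?P) (F i)" for i
    unfolding F_def by (rule sigma_algebra_sigma_sets) (rule GP)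
  ultimately show ?thesis
    by (intro P.kolmogorov_0_1_law)
qed

text \<open>
  Garsia's argument: if the partial sums were unbounded almost surely, then the positive parts \<open>m n\<close>
  of their maxima would satisfy \<open>m (n + 1) - m n \<circ> left_shift \<longlonglongrightarrow> f\<close> pointwise and dominatedly, while the
  integral of the left-hand side is nonnegative by shift invariance and monotonicity of \<open>m\<close>.
\<close>

lemma negative_mean_partial_sums_bounded:
  assumes "prob_space D" and f: "integrable (PiM UNIV (\<lambda>_::nat. D)) f"
    and neg: "(\<integral>\<omega>. f \<omega> \<partial>PiM UNIV (\<lambda>_::nat. D)) < 0"
  shows "AE \<omega> in PiM UNIV (\<lambda>_::nat. D). \<exists>K. \<forall>n. (\<Sum>i<n. f ((left_shift ^^ i) \<omega>)) \<le> (K::real)"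
proof -
  let ?P = "PiM UNIV (\<lambda>_::nat. D)"
  interpret P: prob_space ?P
    using assms(1) by (intro prob_space_PiM)
  note [measurable] = measurable_shift borel_measurable_integrable[OF f]
  have T_space: "left_shift \<omega> \<in> space ?P" if "\<omega> \<in> space ?P" for \<omega>
    using that measurable_space[OF measurable_shift] by blast
  define S where "S n \<omega> = (\<Sum>i<n. f ((left_shift ^^ i) \<omega>))" for n \<omega>
  have S_Suc: "S (Suc n) \<omega> = f \<omega> + S n (left_shift \<omega>)" for n \<omega>
    unfolding S_def sum.lessThan_Suc_shift by (simp add: funpow_swap1)
  have S_meas[measurable]: "S n \<in> borel_measurable ?P" for n
  proof (induction n)
    case (Suc n)
    note [measurable] = Suc
    have "S (Suc n) = (\<lambda>\<omega>. f \<omega> + S n (left_shift \<omega>))"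
      by (rule ext) (rule S_Suc)
    then show ?case
      by simp
  qed (simp add: S_def[abs_def])
  \<comment> \<open>The event that the partial sums are unbounded above. Integer thresholds make it
    a countable combination of measurable sets; \<open>E_alt\<close> restores real
    thresholds.\<close>
  define E where "E = {\<omega>\<in>space ?P. \<forall>K::nat. \<exists>n. S n \<omega> > real K}"
  have E_alt: "\<omega> \<in> E \<longleftrightarrow> (\<forall>K. \<exists>n. S n \<omega> > K)" if "\<omega> \<in> space ?P" for \<omega>
  proof
    assume E: "\<omega> \<in> E"
    show "\<forall>K. \<exists>n. S n \<omega> > K"
    proof
      fix K
      obtain k where "K \<le> real k"
        using real_arch_simple by blast
      moreover obtain n where "S n \<omega> > real k"
        using E unfolding E_def by blast
      ultimately show "\<exists>n. S n \<omega> > K"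
        by (meson le_less_trans)
    qed
  qed (use that in \<open>auto simp: E_def\<close>)
  have "\<omega> \<in> E \<longleftrightarrow> left_shift \<omega> \<in> E" if \<omega>: "\<omega> \<in> space ?P" for \<omega>
  proof
    assume "\<omega> \<in> E"
    then have *: "\<exists>n. S n \<omega> > K" for K
      using E_alt \<omega> by blast
    have "\<exists>n. S n (left_shift \<omega>) > K" for K
    proof -
      \<comment> \<open>The 0 in the maximum excludes \<open>n = 0\<close>, where the sum is empty,
        so that \<open>S_Suc\<close> can be used.\<close>
      obtain n where n: "S n \<omega> > max 0 (K + f \<omega>)"
        using * by blast
      then have "n \<noteq> 0"
        by (cases n) (auto simp: S_def)
      then obtain m where "n = Suc m"
        using not0_implies_Suc by blast
      with n have "S m (left_shift \<omega>) > K"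
        by (auto simp: S_Suc)
      then show ?thesis ..
    qed
    then show "left_shift \<omega> \<in> E"
      using E_alt T_space \<omega> by blast
  next
    assume "left_shift \<omega> \<in> E"
    then have "\<exists>n. S n (left_shift \<omega>) > K - f \<omega>" for K
      using E_alt T_space \<omega> by blast
    then have "\<exists>n. S (Suc n) \<omega> > K" for K
      unfolding S_Suc by (metis add.commute diff_less_eq)
    then show "\<omega> \<in> E"
      using E_alt \<omega> by blast
  qed
  moreover have E[measurable]: "E \<in> sets ?P"
    unfolding E_def by measurable
  ultimately have "measure ?P E = 0 \<or> measure ?P E = 1"
    using assms(1) by (intro shift_invariant_0_1)
  moreover have "measure ?P E \<noteq> 1"
  proof
    assume "measure ?P E = 1"
    then have "AE \<omega> in ?P. \<omega> \<in> E"
      using P.AE_in_set_eq_1 by simp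
    then have "AE \<omega> in distr ?P ?P left_shift. \<omega> \<in> E"
      by (simp only: distr_PiM_shift[OF assms(1)])
    then have AE_E: "AE \<omega> in ?P. left_shift \<omega> \<in> E"
      by (subst (asm) AE_distr_iff) (auto simp: E_def)
    \<comment> \<open>Unrolled, \<open>m n \<omega>\<close> is the maximum of
      \<open>S 0 \<omega>\<close>, ..., \<open>S n \<omega>\<close>, where
      \<open>S 0 \<omega> = 0\<close>.\<close>
    define m where "m = rec_nat (\<lambda>_. 0) (\<lambda>_ g \<omega>. max 0 (f \<omega> + g (left_shift \<omega>)))"
    have m0: "m 0 = (\<lambda>_. 0)" and mS: "m (Suc n) = (\<lambda>\<omega>. max 0 (f \<omega> + m n (left_shift \<omega>)))" for n
      by (simp_all add: m_def)
    have m_nonneg: "0 \<le> m n \<omega>" for n \<omega>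
      by (cases n) (auto simp: m0 mS)
    have m_mono: "m n \<omega> \<le> m (Suc n) \<omega>" for n \<omega>
    proof (induction n arbitrary: \<omega>)
      case 0
      then show ?case by (simp add: m0 mS)
    next
      case (Suc n)
      then show ?case
        by (subst (1 2) mS) (metis add_left_mono max.mono order_refl)
    qed
    have S_le: "S n \<omega> \<le> m n \<omega>" for n \<omega>
    proof (induction n arbitrary: \<omega>)
      case 0
      then show ?case by (simp add: m0 S_def)
    next
      case (Suc n)
      then have "f \<omega> + S n (left_shift \<omega>) \<le> f \<omega> + m n (left_shift \<omega>)"
        by simp
      then show ?case
        by (simp add: S_Suc mS)
    qed
    have int_shift: "integrable ?P (\<lambda>\<omega>. g (left_shift \<omega>))" if "integrable ?P g" for g :: "_ \<Rightarrow> real"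
      using that integrable_distr[OF measurable_shift, of D g]
      by (simp only: distr_PiM_shift[OF assms(1)])
    have integral_shift: "(\<integral>\<omega>. g (left_shift \<omega>) \<partial>?P) = (\<integral>\<omega>. g \<omega> \<partial>?P)"
      if "integrable ?P g" for g :: "_ \<Rightarrow> real"
      using integral_distr[OF measurable_shift borel_measurable_integrable[OF that]]
      by (simp only: distr_PiM_shift[OF assms(1)])
    have m_int: "integrable ?P (m n)" for n
    proof (induction n)
      case (Suc n)
      then show ?case
        unfolding mS using f int_shift[OF Suc] by (intro integrable_max) auto
    qed (simp add: m0)
    define g where "g n \<omega> = m (Suc n) \<omega> - m n (left_shift \<omega>)" for n \<omega>
    \<comment> \<open>As \<open>m n\<close> is nonnegative, this form bounds \<open>g n\<close> by
      the absolute value of \<open>f\<close>. It also shows that \<open>g n \<omega>\<close> is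
      exactly \<open>f \<omega>\<close> once \<open>m n (left_shift \<omega>)\<close> exceeds
      \<open>- f \<omega>\<close>.\<close>
    have g_eq: "g n \<omega> = max (- m n (left_shift \<omega>)) (f \<omega>)" for n \<omega>
      unfolding g_def mS by auto
    have g_int: "integrable ?P (g n)" for n
      unfolding g_def[abs_def]
      by (rule Bochner_Integration.integrable_diff[OF m_int int_shift[OF m_int]])
    have "0 \<le> (\<integral>\<omega>. g n \<omega> \<partial>?P)" for n
    proof -
      have "(\<integral>\<omega>. m n (left_shift \<omega>) \<partial>?P) \<le> (\<integral>\<omega>. m (Suc n) \<omega> \<partial>?P)"
        unfolding integral_shift[OF m_int] by (intro integral_mono m_int m_mono)
      then show ?thesis
        unfolding g_def[abs_def] Bochner_Integration.integral_diff[OF m_int int_shift[OF m_int]]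
        by simp
    qed
    moreover have "(\<lambda>n. \<integral>\<omega>. g n \<omega> \<partial>?P) \<longlonglongrightarrow> (\<integral>\<omega>. f \<omega> \<partial>?P)"
    proof (rule integral_dominated_convergence[where w = "\<lambda>\<omega>. \<bar>f \<omega>\<bar>"])
      show "AE \<omega> in ?P. (\<lambda>n. g n \<omega>) \<longlonglongrightarrow> f \<omega>"
        using AE_E AE_space
      proof eventually_elim
        case (elim \<omega>)
        then obtain n where "S n (left_shift \<omega>) > - f \<omega>"
          using E_alt T_space by blast
        then have "m n (left_shift \<omega>) > - f \<omega>"
          using S_le[of n "left_shift \<omega>"] by linarith
        moreover have "m n (left_shift \<omega>) \<le> m k (left_shift \<omega>)" if "n \<le> k" for k
          using that by (rule lift_Suc_mono_le[rotated]) (rule m_mono)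
        ultimately have "g k \<omega> = f \<omega>" if "n \<le> k" for k
          using that unfolding g_eq by (smt (verit))
        then have "eventually (\<lambda>k. g k \<omega> = f \<omega>) sequentially"
          by (auto simp: eventually_sequentially)
        then show ?case
          by (rule tendsto_eventually)
      qed
      show "AE \<omega> in ?P. norm (g n \<omega>) \<le> \<bar>f \<omega>\<bar>" for n
        using m_nonneg[of n] unfolding g_eq by (intro AE_I2) (smt (verit) real_norm_def)
    qed (use f g_int in \<open>auto intro: borel_measurable_integrable\<close>)
    ultimately have "0 \<le> (\<integral>\<omega>. f \<omega> \<partial>?P)"
      by (intro LIMSEQ_le_const) auto
    with neg show False
      by simp
  qed
  ultimately have "AE \<omega> in ?P. \<omega> \<notin> E"
    using E P.prob_eq_0 by blast
  then show ?thesis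
    using AE_space
  proof eventually_elim
    case (elim \<omega>)
    then show ?case
      using E_alt[of \<omega>] unfolding S_def by (meson not_le)
  qed
qed

section \<open>Sequences of order o(n)\<close>

text \<open>This is \<open>u n = o(n)\<close>, written with an additive constant that is valid for
  all \<open>n\<close> instead of a threshold for \<open>n\<close>, so that estimates combine by
  adding constants.\<close>

definition sublinear :: "(nat \<Rightarrow> real) \<Rightarrow> bool" where
  "sublinear u \<longleftrightarrow> (\<forall>\<epsilon>>0. \<exists>K. \<forall>n. \<bar>u n\<bar> \<le> \<epsilon> * real n + K)"

text \<open>Countably many slopes suffice, which allows the slopes to be treated one at a time up to
  null sets.\<close>

lemma sublinear_if_reciprocals:
  assumes "\<And>m::nat. \<exists>K. \<forall>n. u n \<le> real n / real (Suc m) + K"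
    and "\<And>m::nat. \<exists>K. \<forall>n. - u n \<le> real n / real (Suc m) + K"
  shows "sublinear u"
  unfolding sublinear_def
proof (intro allI impI)
  fix \<epsilon> :: real assume "\<epsilon> > 0"
  then obtain m where m: "1 / real (Suc m) < \<epsilon>"
    using nat_approx_posE by blast
  obtain K L where K: "\<And>n. u n \<le> real n / real (Suc m) + K"
    and L: "\<And>n. - u n \<le> real n / real (Suc m) + L"
    using assms by meson
  have "\<bar>u n\<bar> \<le> \<epsilon> * real n + max K L" for n
  proof -
    have "1 / real (Suc m) * real n \<le> \<epsilon> * real n"
      using m by (intro mult_right_mono) auto
    then show ?thesis
      using K[of n] L[of n] by auto
  qed
  then show "\<exists>K. \<forall>n. \<bar>u n\<bar> \<le> \<epsilon> * real n + K"
    by blast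
qed

lemma sublinearE:
  assumes "sublinear u" "\<epsilon> > 0"
  obtains K where "\<And>n. \<bar>u n\<bar> \<le> \<epsilon> * real n + K"
  using assms unfolding sublinear_def by blast

lemma sublinear_const: "sublinear (\<lambda>_. c)"
  unfolding sublinear_def by (intro allI impI exI[of _ "\<bar>c\<bar>"]) auto

lemma sublinear_add:
  assumes "sublinear u" "sublinear v"
  shows "sublinear (\<lambda>n. u n + v n)"
  unfolding sublinear_def
proof (intro allI impI)
  fix \<epsilon> :: real assume "\<epsilon> > 0"
  then have "\<epsilon> / 2 > 0" by simp
  obtain K L where "\<And>n. \<bar>u n\<bar> \<le> \<epsilon> / 2 * real n + K" "\<And>n. \<bar>v n\<bar> \<le> \<epsilon> / 2 * real n + L"
    using sublinearE[OF assms(1) \<open>\<epsilon> / 2 > 0\<close>] sublinearE[OF assms(2) \<open>\<epsilon> / 2 > 0\<close>] by metis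
  then have "\<bar>u n + v n\<bar> \<le> \<epsilon> * real n + (K + L)" for n
    using add_mono[of "\<bar>u n\<bar>" "\<epsilon> / 2 * real n + K" "\<bar>v n\<bar>" "\<epsilon> / 2 * real n + L"]
      abs_triangle_ineq[of "u n" "v n"] by fastforce
  then show "\<exists>K. \<forall>n. \<bar>u n + v n\<bar> \<le> \<epsilon> * real n + K"
    by blast
qed

lemma sublinear_uminus: "sublinear u \<Longrightarrow> sublinear (\<lambda>n. - u n)"
  by (simp add: sublinear_def)

lemma sublinear_Suc:
  assumes "sublinear u"
  shows "sublinear (\<lambda>n. u (Suc n))"
  unfolding sublinear_def
proof (intro allI impI)
  fix \<epsilon> :: real assume "\<epsilon> > 0"
  then obtain K where K: "\<And>n. \<bar>u n\<bar> \<le> \<epsilon> * real n + K"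
    using sublinearE[OF assms] by metis
  have "\<bar>u (Suc n)\<bar> \<le> \<epsilon> * real n + (K + \<epsilon>)" for n
    using K[of "Suc n"] by (simp add: algebra_simps)
  then show "\<exists>K. \<forall>n. \<bar>u (Suc n)\<bar> \<le> \<epsilon> * real n + K"
    by blast
qed

text \<open>\<open>d n\<close> is a difference of consecutive partial sums, each of which is a
  multiple of \<open>c\<close> up to o(n). This extracts from the law of large numbers that single
  terms are o(n).\<close>

lemma sublinear_increment:
  assumes "sublinear (\<lambda>n. (\<Sum>i<n. d i) - real n * c)"
  shows "sublinear d"
proof -
  have "sublinear (\<lambda>n. ((\<Sum>i<Suc n. d i) - real (Suc n) * c) + - ((\<Sum>i<n. d i) - real n * c) + c)"
    by (intro sublinear_add sublinear_uminus sublinear_const sublinear_Suc[OF assms] assms)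
  then show ?thesis
    by (simp add: algebra_simps)
qed

lemma sublinear_tendsto:
  assumes "sublinear u"
  shows "(\<lambda>n. u n / real (Suc n)) \<longlonglongrightarrow> 0"
proof (rule LIMSEQ_I)
  fix e :: real assume "e > 0"
  then have "e / 2 > 0" by simp
  with assms obtain K where K: "\<And>n. \<bar>u n\<bar> \<le> e / 2 * real n + K"
    using sublinearE by metis
  obtain N where N: "2 * K / e < real N"
    using reals_Archimedean2 by blast
  have "norm (u n / real (Suc n) - 0) < e" if "N \<le> n" for n
  proof -
    have "K < e / 2 * real N"
      using N \<open>e > 0\<close> by (simp add: field_simps)
    also have "\<dots> \<le> e / 2 * real n"
      using that \<open>e > 0\<close> by simp
    finally have "\<bar>u n\<bar> < e * real (Suc n)"
      using K[of n] \<open>e > 0\<close> by (simp add: algebra_simps)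
    then show ?thesis
      by (simp add: field_simps)
  qed
  then show "\<exists>N. \<forall>n\<ge>N. norm (u n / real (Suc n) - 0) < e"
    by blast
qed

text \<open>For each \<open>m\<close>, the functions \<open>f - \<mu> - 1/(m+1)\<close> and
  \<open>\<mu> - f - 1/(m+1)\<close> have negative mean, so their partial sums are almost surely
  bounded above. This gives the upper and the lower estimate with slope
  \<open>1/(m+1)\<close>.\<close>

lemma shift_law_of_large_numbers:
  assumes "prob_space D" and f: "integrable (PiM UNIV (\<lambda>_::nat. D)) f"
  defines "\<mu> \<equiv> \<integral>\<omega>. f \<omega> \<partial>PiM UNIV (\<lambda>_::nat. D)"
  shows "AE \<omega> in PiM UNIV (\<lambda>_::nat. D). sublinear (\<lambda>n. (\<Sum>i<n. f ((left_shift ^^ i) \<omega>)) - real n * \<mu>)"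
proof -
  let ?P = "PiM UNIV (\<lambda>_::nat. D)"
  interpret P: prob_space ?P
    using assms(1) by (intro prob_space_PiM)
  have "AE \<omega> in ?P. \<forall>m. \<exists>K. \<forall>n. (\<Sum>i<n. f ((left_shift ^^ i) \<omega>) - \<mu> - 1 / real (Suc m)) \<le> K"
    unfolding AE_all_countable
  proof
    fix m :: nat
    show "AE \<omega> in ?P. \<exists>K. \<forall>n. (\<Sum>i<n. f ((left_shift ^^ i) \<omega>) - \<mu> - 1 / real (Suc m)) \<le> K"
      by (rule negative_mean_partial_sums_bounded[OF assms(1)])
        (use f in \<open>auto simp: \<mu>_def P.prob_space\<close>)
  qed
  moreover have "AE \<omega> in ?P. \<forall>m. \<exists>K. \<forall>n. (\<Sum>i<n. \<mu> - f ((left_shift ^^ i) \<omega>) - 1 / real (Suc m)) \<le> K"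
    unfolding AE_all_countable
  proof
    fix m :: nat
    show "AE \<omega> in ?P. \<exists>K. \<forall>n. (\<Sum>i<n. \<mu> - f ((left_shift ^^ i) \<omega>) - 1 / real (Suc m)) \<le> K"
      by (rule negative_mean_partial_sums_bounded[OF assms(1)])
        (use f in \<open>auto simp: \<mu>_def P.prob_space\<close>)
  qed
  ultimately show ?thesis
  proof eventually_elim
    case (elim \<omega>)
    show ?case
    proof (rule sublinear_if_reciprocals)
      fix m :: nat
      show "\<exists>K. \<forall>n. (\<Sum>i<n. f ((left_shift ^^ i) \<omega>)) - real n * \<mu> \<le> real n / real (Suc m) + K"
        using elim(1)[rule_format, of m] unfolding sum_subtractf by (auto simp: algebra_simps)
      show "\<exists>K. \<forall>n. - ((\<Sum>i<n. f ((left_shift ^^ i) \<omega>)) - real n * \<mu>) \<le> real n / real (Suc m) + K"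
        using elim(2)[rule_format, of m] unfolding sum_subtractf by (auto simp: algebra_simps)
    qed
  qed
qed

text \<open>By independence the joint law over the indices from 1 on is a product of equal factors;
  reindexing along \<open>Suc\<close> makes 0 the first index, as the shift results expect.\<close>

lemma iid_sequence_distr_PiM:
  assumes "prob_space M" and Z: "iid_sequence M N Z"
  shows "distr M (PiM UNIV (\<lambda>_. N)) (\<lambda>\<omega> j. Z (Suc j) \<omega>) = PiM UNIV (\<lambda>_. distr M N (Z 1))"
proof -
  interpret prob_space M by fact
  have rv: "Z k \<in> measurable M N" if "k \<ge> 1" for k
    using Z that unfolding iid_sequence_def indep_vars_def by auto
  have D: "prob_space (distr M N (Z k))" if "k \<ge> 1" for k
    using rv[OF that] by (rule prob_space_distr)
  have rvs: "(\<lambda>\<omega>. \<lambda>k\<in>{1..}. Z k \<omega>) \<in> measurable M (PiM {1..} (\<lambda>_. N))"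
    using rv by (intro measurable_restrict) auto
  have "distr M (PiM {1..} (\<lambda>_. N)) (\<lambda>\<omega>. \<lambda>k\<in>{1..}. Z k \<omega>) = PiM {1..} (\<lambda>k. distr M N (Z k))"
  proof (rule indep_vars_iff_distr_eq_PiM'[THEN iffD1])
    show "indep_vars (\<lambda>_. N) Z {1..}"
      using Z unfolding iid_sequence_def by (rule conjunct1)
    show "Z k \<in> measurable M N" if "k \<in> {1..}" for k
      using that by (intro rv) simp
  qed simp
  also have "\<dots> = PiM {1..} (\<lambda>_. distr M N (Z 1))"
  proof (rule PiM_cong[OF refl])
    fix k :: nat assume "k \<in> {1..}"
    then show "distr M N (Z k) = distr M N (Z 1)"
      using Z unfolding iid_sequence_def atLeast_iff by blast
  qed
  finally have eq: "distr M (PiM {1..} (\<lambda>_. N)) (\<lambda>\<omega>. \<lambda>k\<in>{1..}. Z k \<omega>)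
    = PiM {1..} (\<lambda>_. distr M N (Z 1))" .
  have "PiM UNIV (\<lambda>_. distr M N (Z 1)) = distr (PiM {1..} (\<lambda>_. distr M N (Z 1)))
    (PiM UNIV (\<lambda>_. distr M N (Z 1))) (\<lambda>\<omega> n. \<omega> (Suc n))"
    using distr_PiM_reindex[of "{1..}" "\<lambda>_. distr M N (Z 1)" Suc UNIV] D[of 1]
    by (simp add: restrict_UNIV)
  also have "\<dots> = distr (PiM {1..} (\<lambda>_. distr M N (Z 1))) (PiM UNIV (\<lambda>_. N)) (\<lambda>\<omega> n. \<omega> (Suc n))"
    by (intro distr_cong sets_PiM_cong) auto
  also have "\<dots> = distr M (PiM UNIV (\<lambda>_. N)) ((\<lambda>\<omega> n. \<omega> (Suc n)) \<circ> (\<lambda>\<omega>. \<lambda>k\<in>{1..}. Z k \<omega>))"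
    unfolding eq[symmetric]
    by (intro distr_distr rvs measurable_PiM_single')
      (auto simp: space_PiM intro!: measurable_component_singleton)
  finally show ?thesis
    by (simp add: comp_def)
qed

text \<open>Transfer from the product space along the joint law. Since \<open>f\<close> sees the
  whole shifted sequence, summands built from two neighbouring members, such as
  \<open>C(i+1)\<close> and \<open>B(i+2)\<close>, are covered without showing their independence of
  each other.\<close>

lemma iid_sequence_law_of_large_numbers:
  fixes f :: "(nat \<Rightarrow> 'b) \<Rightarrow> real"
  assumes "prob_space M" and Z: "iid_sequence M N Z"
    and f: "f \<in> borel_measurable (PiM UNIV (\<lambda>_. N))"
    and int: "integrable M (\<lambda>\<omega>. f (\<lambda>j. Z (Suc j) \<omega>))"
  shows "AE \<omega> in M. sublinear (\<lambda>n. (\<Sum>i<n. f (\<lambda>j. Z (Suc (i + j)) \<omega>)) -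
    real n * (\<integral>\<omega>. f (\<lambda>j. Z (Suc j) \<omega>) \<partial>M))"
proof -
  interpret prob_space M by fact
  have rv: "Z (Suc k) \<in> measurable M N" for k
    using Z unfolding iid_sequence_def indep_vars_def by auto
  have rvs: "(\<lambda>\<omega> j. Z (Suc j) \<omega>) \<in> measurable M (PiM UNIV (\<lambda>_. N))"
    using rv by (intro measurable_PiM_single') (auto simp: space_PiM dest: measurable_space)
  note D = iid_sequence_distr_PiM[OF assms(1) Z]
  have "integrable (distr M (PiM UNIV (\<lambda>_. N)) (\<lambda>\<omega> j. Z (Suc j) \<omega>)) f"
    using int by (subst integrable_distr_eq) (auto intro: rvs f)
  moreover have "(\<integral>\<omega>. f \<omega> \<partial>distr M (PiM UNIV (\<lambda>_. N)) (\<lambda>\<omega> j. Z (Suc j) \<omega>)) =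
    (\<integral>\<omega>. f (\<lambda>j. Z (Suc j) \<omega>) \<partial>M)"
    by (intro integral_distr rvs f)
  moreover have "prob_space (distr M N (Z 1))"
    using rv[of 0] by (intro prob_space_distr) simp
  ultimately have "AE \<omega> in distr M (PiM UNIV (\<lambda>_. N)) (\<lambda>\<omega> j. Z (Suc j) \<omega>).
    sublinear (\<lambda>n. (\<Sum>i<n. f ((left_shift ^^ i) \<omega>)) - real n * (\<integral>\<omega>. f (\<lambda>j. Z (Suc j) \<omega>) \<partial>M))"
    using shift_law_of_large_numbers[of "distr M N (Z 1)" f] unfolding D by simp
  from AE_distrD[OF rvs this] show ?thesis
    by (simp add: funpow_shift)
qed

section \<open>Growth of triangular recursions\<close>

text \<open>Expresses that the upper limit of \<open>x n / n\<close> is at most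
  \<open>\<mu>\<close>, for sequences that may take the value -\<infinity> but not
  \<infinity>.\<close>

definition growth_le :: "(nat \<Rightarrow> ereal) \<Rightarrow> real \<Rightarrow> bool" where
  "growth_le x \<mu> \<longleftrightarrow> (\<forall>\<epsilon>>0. \<exists>K. \<forall>n. x n \<le> ereal (real n * (\<mu> + \<epsilon>) + K))"

lemma growth_leE:
  assumes "growth_le x \<mu>" "\<epsilon> > 0"
  obtains K where "\<And>n. x n \<le> ereal (real n * (\<mu> + \<epsilon>) + K)"
  using assms unfolding growth_le_def by blast

lemma growth_le_sup:
  assumes "growth_le x \<mu>" "growth_le y \<mu>"
  shows "growth_le (\<lambda>n. sup (x n) (y n)) \<mu>"
  unfolding growth_le_def
proof (intro allI impI)
  fix \<epsilon> :: real assume "\<epsilon> > 0"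
  then obtain K L where K: "\<And>n. x n \<le> ereal (real n * (\<mu> + \<epsilon>) + K)"
    and L: "\<And>n. y n \<le> ereal (real n * (\<mu> + \<epsilon>) + L)"
    using growth_leE[OF assms(1)] growth_leE[OF assms(2)] by metis
  have "sup (x n) (y n) \<le> ereal (real n * (\<mu> + \<epsilon>) + max K L)" for n
    by (intro le_supI order_trans[OF K] order_trans[OF L]) auto
  then show "\<exists>K. \<forall>n. sup (x n) (y n) \<le> ereal (real n * (\<mu> + \<epsilon>) + K)"
    by blast
qed

lemma growth_le_SUP:
  assumes "finite I" "\<And>i. i \<in> I \<Longrightarrow> growth_le (\<lambda>n. x n i) \<mu>"
  shows "growth_le (\<lambda>n. SUP i\<in>I. x n i) \<mu>"
  using assms
proof (induction I rule: finite_induct)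
  case empty
  then show ?case by (simp add: growth_le_def bot_ereal_def)
next
  case (insert i I)
  then show ?case using growth_le_sup[of "\<lambda>n. x n i" \<mu>] by simp
qed

lemma growth_le_add:
  assumes "growth_le x \<mu>" "sublinear w" "\<And>n. t n \<le> ereal (w n)"
  shows "growth_le (\<lambda>n. x n + t n) \<mu>"
  unfolding growth_le_def
proof (intro allI impI)
  fix \<epsilon> :: real assume "\<epsilon> > 0"
  then have "\<epsilon> / 2 > 0" by simp
  obtain K L where KL: "\<And>n. x n \<le> ereal (real n * (\<mu> + \<epsilon> / 2) + K)"
    "\<And>n. \<bar>w n\<bar> \<le> \<epsilon> / 2 * real n + L"
    using growth_leE[OF assms(1) \<open>\<epsilon> / 2 > 0\<close>] sublinearE[OF assms(2) \<open>\<epsilon> / 2 > 0\<close>] by metis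
  have "x n + t n \<le> ereal (real n * (\<mu> + \<epsilon>) + (K + L))" for n
  proof -
    have "x n + t n \<le> ereal (real n * (\<mu> + \<epsilon> / 2) + K) + ereal (w n)"
      using KL assms(3) by (intro add_mono)
    also have "\<dots> \<le> ereal (real n * (\<mu> + \<epsilon> / 2) + K + (\<epsilon> / 2 * real n + L))"
      using KL(2)[of n] by simp
    also have "\<dots> = ereal (real n * (\<mu> + \<epsilon>) + (K + L))"
      by (simp add: algebra_simps)
    finally show ?thesis .
  qed
  then show "\<exists>K. \<forall>n. x n + t n \<le> ereal (real n * (\<mu> + \<epsilon>) + K)"
    by blast
qed

text \<open>Unrolled, \<open>x n\<close> is bounded by the best way of starting at
  \<open>x 0\<close> or entering through some \<open>y i\<close> and then collecting the remaining
  \<open>d\<close> terms. Both the entry and the collected sum grow at rate at most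
  \<open>\<mu>\<close>. If \<open>d\<close> is constantly -\<infinity>, only the last entry
  counts.\<close>

lemma growth_le_recursion:
  assumes rec: "\<And>n. x (Suc n) \<le> max (x n + d n) (y n)"
    and fin: "\<And>n. x n \<noteq> \<infinity>"
    and y: "growth_le y \<mu>"
    and d: "(\<forall>n. d n = -\<infinity>) \<or>
      (\<exists>\<nu>\<le>\<mu>. \<exists>s. (\<forall>n. d n = ereal (s n)) \<and> sublinear (\<lambda>n. (\<Sum>i<n. s i) - real n * \<nu>))"
  shows "growth_le x \<mu>"
  unfolding growth_le_def
proof (intro allI impI)
  fix \<epsilon> :: real assume \<epsilon>: "\<epsilon> > 0"
  then have \<epsilon>4: "\<epsilon> / 4 > 0" by simp
  from y \<epsilon>4 obtain K where K: "\<And>n. y n \<le> ereal (real n * (\<mu> + \<epsilon> / 4) + K)"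
    using growth_leE by metis
  obtain K0 where K0: "x 0 \<le> ereal K0"
    using fin[of 0] by (cases "x 0") auto
  from d show "\<exists>K. \<forall>n. x n \<le> ereal (real n * (\<mu> + \<epsilon>) + K)"
  proof
    assume d: "\<forall>n. d n = -\<infinity>"
    have "x n \<le> ereal (real n * (\<mu> + \<epsilon>) + (\<bar>K0\<bar> + \<bar>K\<bar> + \<bar>\<mu>\<bar>))" for n
    proof (cases n)
      case 0
      then show ?thesis
        by (simp add: order_trans[OF K0])
    next
      case (Suc m)
      have "x n \<le> y m"
        using rec[of m] fin[of m] d Suc by (cases "x m") (auto simp: max_def split: if_splits)
      also note K[of m]
      also have "real m * (\<mu> + \<epsilon> / 4) + K \<le> real n * (\<mu> + \<epsilon>) + (\<bar>K0\<bar> + \<bar>K\<bar> + \<bar>\<mu>\<bar>)"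
      proof -
        have "real m * (\<epsilon> / 4) \<le> real n * \<epsilon>"
          using \<epsilon> Suc by (intro mult_mono) auto
        then show ?thesis
          using Suc by (simp add: algebra_simps)
      qed
      finally show ?thesis by simp
    qed
    then show ?thesis by blast
  next
    assume "\<exists>\<nu>\<le>\<mu>. \<exists>s. (\<forall>n. d n = ereal (s n)) \<and> sublinear (\<lambda>n. (\<Sum>i<n. s i) - real n * \<nu>)"
    then obtain \<nu> s where \<nu>: "\<nu> \<le> \<mu>" and s: "\<And>n. d n = ereal (s n)"
      and sub: "sublinear (\<lambda>n. (\<Sum>i<n. s i) - real n * \<nu>)"
      by blast
    obtain L where L: "\<And>n. \<bar>(\<Sum>i<n. s i) - real n * \<nu>\<bar> \<le> \<epsilon> / 4 * real n + L"
      using sublinearE[OF sub \<epsilon>4] by blast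
    \<comment> \<open>\<open>R\<close> absorbs the initial value, the constant of \<open>y\<close>
      and the error of the partial sums; the absolute value of \<open>\<mu>\<close> pays for
      comparing \<open>y n\<close> with the bound at \<open>Suc n\<close>.\<close>
    define R where "R = \<bar>K0\<bar> + \<bar>K\<bar> + L + \<bar>\<mu>\<bar>"
    \<comment> \<open>The term with \<open>\<mu> - \<nu>\<close> lifts the drift from
      \<open>\<nu>\<close> to \<open>\<mu>\<close>. The slack \<open>\<epsilon> / 2\<close> is spent
      in equal parts on the partial sums and on the growth of \<open>y\<close>.\<close>
    have *: "x n \<le> ereal ((\<Sum>i<n. s i) + real n * (\<mu> - \<nu>) + \<epsilon> / 2 * real n + R)" for n
    proof (induction n)
      case 0
      have "K0 \<le> R"
        using L[of 0] by (simp add: R_def)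
      then show ?case
        using K0 by (auto intro: order_trans)
    next
      case (Suc n)
      let ?S = "\<Sum>i<Suc n. s i"
      let ?b = "?S + real (Suc n) * (\<mu> - \<nu>) + \<epsilon> / 2 * real (Suc n) + R"
      have "x n + d n \<le> ereal ((\<Sum>i<n. s i) + real n * (\<mu> - \<nu>) + \<epsilon> / 2 * real n + R) + ereal (s n)"
        unfolding s using Suc by (intro add_mono) auto
      also have "\<dots> \<le> ereal ?b"
        using \<nu> \<epsilon> by (simp add: algebra_simps add_divide_distrib)
      finally have 1: "x n + d n \<le> ereal ?b" .
      have "real n * (\<mu> + \<epsilon> / 4) + K \<le> ?b"
      proof -
        have "\<bar>?S - real (Suc n) * \<nu>\<bar> \<le> \<epsilon> / 4 * real (Suc n) + L"
          by (rule L)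
        then have "?S + L \<ge> real n * \<nu> + \<nu> - \<epsilon> * real n / 4 - \<epsilon> / 4"
          unfolding abs_le_iff by (simp add: algebra_simps add_divide_distrib del: sum.lessThan_Suc)
        moreover have "0 \<le> \<epsilon> * real n"
          using \<epsilon> by simp
        ultimately show ?thesis
          using \<epsilon> by (simp add: R_def algebra_simps add_divide_distrib del: sum.lessThan_Suc)
      qed
      then have 2: "y n \<le> ereal ?b"
        by (intro order_trans[OF K]) (simp only: ereal_less_eq)
      show ?case
        by (rule order_trans[OF rec max.boundedI[OF 1 2]])
    qed
    have "x n \<le> ereal (real n * (\<mu> + \<epsilon>) + (R + L))" for n
    proof -
      have "(\<Sum>i<n. s i) + real n * (\<mu> - \<nu>) + \<epsilon> / 2 * real n + R \<le> real n * (\<mu> + \<epsilon>) + (R + L)"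
      proof -
        have "0 \<le> \<epsilon> * real n"
          using \<epsilon> by simp
        then show ?thesis
          using L[of n] by (simp add: algebra_simps abs_le_iff add_divide_distrib)
      qed
      then show ?thesis
        by (intro order_trans[OF *]) (simp only: ereal_less_eq)
    qed
    then show ?thesis by blast
  qed
qed

lemma ereal_finite_SUP_neq_PInf:
  fixes f :: "'i \<Rightarrow> ereal"
  assumes "finite I" "\<And>i. i \<in> I \<Longrightarrow> f i \<noteq> \<infinity>"
  shows "(SUP i\<in>I. f i) \<noteq> \<infinity>"
  using assms
  by (induction I rule: finite_induct) (auto simp: bot_ereal_def sup_max max_def)

lemma ereal_SUP_eq_MInf: "(SUP i\<in>I. f i :: ereal) = -\<infinity> \<longleftrightarrow> (\<forall>i\<in>I. f i = -\<infinity>)"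
  using SUP_bot_conv(1)[of f I] by (simp add: bot_ereal_def)

text \<open>Well-founded induction on the index: what arrives from strict predecessors has rate
  \<open>\<mu>\<close> by induction, and sublinear off-diagonal weights do not change this rate; the
  diagonal weight is handled by \<open>growth_le_recursion\<close>. A general \<open>r\<close>
  serves both orientations of triangularity.\<close>

lemma growth_le_triangular:
  fixes x :: "nat \<Rightarrow> 'r::finite \<Rightarrow> ereal"
  assumes "wf r"
    and rec: "\<And>n q. x (Suc n) q = (SUP p. x n p + t n p q)"
    and fin: "\<And>n p. x n p \<noteq> \<infinity>"
    and tri: "\<And>n p q. t n p q \<noteq> -\<infinity> \<Longrightarrow> p = q \<or> (p, q) \<in> r"
    and off: "\<And>p q. \<exists>w. sublinear w \<and> (\<forall>n. t n p q \<le> ereal (w n))"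
    and diag: "\<And>q. (\<forall>n. t n q q = -\<infinity>) \<or> (\<exists>\<nu>\<le>\<mu>. \<exists>s. (\<forall>n. t n q q = ereal (s n)) \<and>
      sublinear (\<lambda>n. (\<Sum>i<n. s i) - real n * \<nu>))"
  shows "growth_le (\<lambda>n. x n q) \<mu>"
  using \<open>wf r\<close>
proof (induction q rule: wf_induct_rule)
  case (less q)
  let ?y = "\<lambda>n. SUP p\<in>{p. (p, q) \<in> r}. x n p + t n p q"
  show ?case
  proof (rule growth_le_recursion[where x = "\<lambda>n. x n q" and d = "\<lambda>n. t n q q" and y = ?y])
    show "growth_le ?y \<mu>"
    proof (rule growth_le_SUP)
      fix p assume "p \<in> {p. (p, q) \<in> r}"
      then show "growth_le (\<lambda>n. x n p + t n p q) \<mu>"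
        using less[of p] off[of p q] growth_le_add[of "\<lambda>n. x n p" \<mu> _ "\<lambda>n. t n p q"] by auto
    qed simp
    show "x n q \<noteq> \<infinity>" for n
      by (rule fin)
    show "(\<forall>n. t n q q = -\<infinity>) \<or> (\<exists>\<nu>\<le>\<mu>. \<exists>s. (\<forall>n. t n q q = ereal (s n)) \<and>
      sublinear (\<lambda>n. (\<Sum>i<n. s i) - real n * \<nu>))"
      by (rule diag)
    show "x (Suc n) q \<le> max (x n q + t n q q) (?y n)" for n
      unfolding rec
    proof (rule SUP_least)
      fix p
      consider "p = q" | "(p, q) \<in> r" | "t n p q = -\<infinity>"
        using tri by blast
      then show "x n p + t n p q \<le> max (x n q + t n q q) (?y n)"
      proof cases
        case 2
        then show ?thesis
          by (intro max.coboundedI2 SUP_upper) simp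
      next
        \<comment> \<open>In \<open>ereal\<close>, \<infinity> plus -\<infinity> is \<infinity>, so
          -\<infinity> absorbs \<open>x n p\<close> only because \<open>x n p\<close> is not
          \<infinity>.\<close>
        case 3
        then show ?thesis
          using fin[of n p] by (cases "x n p") auto
      qed simp
    qed
  qed
qed

section \<open>Max-plus matrix products\<close>

lemma mp_mult_nth: "(B \<otimes>\<^sub>m C) $ i $ j = (SUP l. B $ i $ l + C $ l $ j)"
  by (simp add: mp_mult_def)

text \<open>A monotone map commutes with the maximum of a nonempty finite set.\<close>

lemma ereal_finite_add_SUP:
  fixes f :: "'i \<Rightarrow> ereal"
  assumes "finite I" "I \<noteq> {}"
  shows "c + (SUP i\<in>I. f i) = (SUP i\<in>I. c + f i)"
proof -
  have "c + Max (f ` I) = Max ((\<lambda>x. c + x) ` f ` I)"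
    using assms by (intro mono_Max_commute) (auto simp: mono_def add_left_mono)
  then show ?thesis
    using assms by (simp add: Max_Sup image_image)
qed

text \<open>Distributivity turns both sides into one supremum over pairs of inner indices.\<close>

lemma mp_mult_assoc: "(X \<otimes>\<^sub>m Y) \<otimes>\<^sub>m Z = X \<otimes>\<^sub>m (Y \<otimes>\<^sub>m Z)"
proof -
  have "(SUP l. (SUP m. X $ i $ m + Y $ m $ l) + Z $ l $ j) =
    (SUP m. X $ i $ m + (SUP l. Y $ m $ l + Z $ l $ j))" for i j
  proof -
    have "(SUP l. (SUP m. X $ i $ m + Y $ m $ l) + Z $ l $ j) =
      (SUP l. SUP m. X $ i $ m + (Y $ m $ l + Z $ l $ j))"
      by (subst add.commute) (simp add: ereal_finite_add_SUP ac_simps)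
    also have "\<dots> = (SUP m. X $ i $ m + (SUP l. Y $ m $ l + Z $ l $ j))"
      by (subst SUP_commute) (simp add: ereal_finite_add_SUP)
    finally show ?thesis .
  qed
  then show ?thesis
    by (simp add: vec_eq_iff mp_mult_nth)
qed

lemma mp_mult_neq_PInf:
  assumes "\<And>i l. X $ i $ l \<noteq> \<infinity>" "\<And>l j. Y $ l $ j \<noteq> \<infinity>"
  shows "(X \<otimes>\<^sub>m Y) $ i $ j \<noteq> \<infinity>"
  unfolding mp_mult_nth using assms by (intro ereal_finite_SUP_neq_PInf) auto

lemma mp_mult_eq_MInf:
  assumes "\<And>i l. X $ i $ l \<noteq> \<infinity>" "\<And>l j. Y $ l $ j \<noteq> \<infinity>"
  shows "(X \<otimes>\<^sub>m Y) $ i $ j = -\<infinity> \<longleftrightarrow> (\<forall>l. X $ i $ l = -\<infinity> \<or> Y $ l $ j = -\<infinity>)"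
  using assms by (auto simp: mp_mult_nth ereal_SUP_eq_MInf ereal_plus_eq_MInfty)

section \<open>Directed graphs of finite entries and their cycles\<close>

text \<open>The directed graph of a matrix. For matrices without entry \<infinity>, multiplication
  becomes relational composition, so finite entries of powers are walks.\<close>

definition support_rel :: "ereal^'m^'n \<Rightarrow> ('n \<times> 'm) set" where
  "support_rel X = {(i, j). X $ i $ j \<noteq> -\<infinity>}"

lemma support_rel_mult:
  assumes "\<And>i l. X $ i $ l \<noteq> \<infinity>" "\<And>l j. Y $ l $ j \<noteq> \<infinity>"
  shows "support_rel (X \<otimes>\<^sub>m Y) = support_rel X O support_rel Y"
  using assms by (auto simp: support_rel_def mp_mult_eq_MInf)

lemma mp_one_mult:
  assumes "\<And>i j. X $ i $ j \<noteq> \<infinity>"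
  shows "mp_one \<otimes>\<^sub>m X = X"
proof -
  have "(SUP l. (if i = l then 0 else -\<infinity>) + X $ l $ j) = X $ i $ j" for i j
  proof (rule antisym)
    show "(SUP l. (if i = l then 0 else -\<infinity>) + X $ l $ j) \<le> X $ i $ j"
    proof (rule SUP_least)
      fix l
      show "(if i = l then 0 else -\<infinity>) + X $ l $ j \<le> X $ i $ j"
        using assms[of l j] by (cases "X $ l $ j") auto
    qed
    show "X $ i $ j \<le> (SUP l. (if i = l then 0 else -\<infinity>) + X $ l $ j)"
      by (rule SUP_upper2[of i]) auto
  qed
  then show ?thesis
    by (simp add: vec_eq_iff mp_mult_nth mp_one_def)
qed

lemma mp_power_neq_PInf:
  assumes "\<And>i j. X $ i $ j \<noteq> \<infinity>"
  shows "mp_power X m $ i $ j \<noteq> \<infinity>"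
proof (induction m arbitrary: i j)
  case (Suc m)
  show ?case
    unfolding mp_power.simps by (rule mp_mult_neq_PInf[OF Suc assms])
qed (simp add: mp_one_def)

lemma support_rel_power:
  assumes "\<And>i j. X $ i $ j \<noteq> \<infinity>"
  shows "support_rel (mp_power X m) = support_rel X ^^ m"
proof (induction m)
  case (Suc m)
  then show ?case
    by (simp add: support_rel_mult mp_power_neq_PInf assms)
qed (auto simp: support_rel_def mp_one_def)

text \<open>Some power with exponent at least 1 has a diagonal entry other than -\<infinity>, and
  such an entry is a closed walk in the graph.\<close>

lemma spectral_radius_cycle:
  assumes "\<And>i j. X $ i $ j \<noteq> \<infinity>" "mp_spectral_radius X > -\<infinity>"
  shows "\<exists>i. (i, i) \<in> (support_rel X)\<^sup>+"
proof -
  obtain m where m: "m \<ge> 1" "mp_powr (mp_trace (mp_power X m)) (1 / real m) > -\<infinity>"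
    using assms(2) unfolding mp_spectral_radius_def less_SUP_iff by auto
  \<comment> \<open>\<open>1 / real m\<close> is positive, so scaling by it would keep a trace of
    -\<infinity> at -\<infinity>.\<close>
  have "mp_trace (mp_power X m) \<noteq> -\<infinity>"
    using m by (auto simp: mp_powr_def)
  then obtain i where "(i, i) \<in> support_rel (mp_power X m)"
    unfolding mp_trace_def ereal_SUP_eq_MInf by (auto simp: support_rel_def)
  then have "(i, i) \<in> support_rel X ^^ m"
    using assms(1) by (simp add: support_rel_power)
  then show ?thesis
    using m(1) trancl_power[of "(i, i)"] by (metis One_nat_def Suc_le_eq)
qed

text \<open>Start the closed walk of alternating \<open>U\<close>- and \<open>V\<close>-steps one
  step later, at the vertex reached by its first \<open>U\<close>-step. The induction keeps the end
  point free and splits off the first \<open>U\<close>-step and the last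
  \<open>V\<close>-step.\<close>

lemma cycle_relcomp_swap:
  assumes "(i, i) \<in> (U O V)\<^sup>+"
  shows "\<exists>l. (l, l) \<in> (V O U)\<^sup>+"
proof -
  have "\<exists>l l'. (i, l) \<in> U \<and> (l, l') \<in> (V O U)\<^sup>* \<and> (l', j) \<in> V" if "(i, j) \<in> (U O V)\<^sup>+" for j
    using that
  proof (induction rule: trancl_induct)
    case (step j k)
    obtain m where m: "(j, m) \<in> U" "(m, k) \<in> V"
      using step.hyps by (elim relcompE) auto
    obtain l l' where l: "(i, l) \<in> U" "(l, l') \<in> (V O U)\<^sup>*" "(l', j) \<in> V"
      using step.IH by (elim exE conjE)
    have "(l, m) \<in> (V O U)\<^sup>*"
      using l(2) relcompI[OF l(3) m(1)] by (rule rtrancl_into_rtrancl)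
    then show ?case
      using l(1) m(2) by (intro exI conjI)
  qed blast
  then obtain l l' where "(i, l) \<in> U" "(l, l') \<in> (V O U)\<^sup>*" "(l', i) \<in> V"
    using assms by metis
  then have "(l, l) \<in> (V O U)\<^sup>+"
    by (metis relcompI rtrancl_into_trancl1)
  then show ?thesis ..
qed

text \<open>Without a loop, \<open>R\<close> would lie inside the strict order \<open>r\<close>,
  which has no cycles.\<close>

lemma triangular_cycle:
  assumes "(l, l) \<in> R\<^sup>+" "trans r" "irrefl r" "\<And>p q. (p, q) \<in> R \<Longrightarrow> p = q \<or> (p, q) \<in> r"
  shows "\<exists>p. (p, p) \<in> R"
proof (rule ccontr)
  assume "\<nexists>p. (p, p) \<in> R"
  then have "R \<subseteq> r"
    using assms(4) by auto
  then have "(l, l) \<in> r"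
    using trancl_mono[OF assms(1), of r] trancl_id[OF assms(2)] by simp
  then show False
    using assms(3) by (simp add: irrefl_def)
qed

section \<open>The growth rate of a single realization\<close>

text \<open>Associativity moves the brackets of \<open>Y 1 Z 1 Y 2 Z 2 ...\<close> onto the pairs
  \<open>Z i Y (i+1)\<close>; a product of \<open>k + 1\<close> matrices has \<open>k\<close> such
  pairs. That \<open>X 1\<close> avoids \<infinity> makes the initial factor \<open>mp_one\<close>
  neutral.\<close>

lemma mp_prod_eq:
  assumes "\<And>k. k \<ge> 1 \<Longrightarrow> X k = Y k \<otimes>\<^sub>m Z k" "\<And>i j. X 1 $ i $ j \<noteq> \<infinity>"
  shows "mp_prod X (Suc k) =
    rec_nat (Y 1) (\<lambda>k W. W \<otimes>\<^sub>m (Z (Suc k) \<otimes>\<^sub>m Y (Suc (Suc k)))) k \<otimes>\<^sub>m Z (Suc k)"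
proof (induction k)
  case 0
  then show ?case
    using assms by (simp add: mp_one_mult)
next
  case (Suc k)
  then show ?case
    using assms(1)[of "Suc (Suc k)"] by (simp add: mp_mult_assoc)
qed

lemma growth_limit:
  assumes up: "growth_le N \<mu>" and low: "\<And>k. ereal (s k) \<le> N k"
    and s: "sublinear (\<lambda>k. s k - real k * \<mu>)"
  shows "(\<lambda>k. N k * ereal (1 / real (Suc k))) \<longlonglongrightarrow> ereal \<mu>"
proof -
  define n where "n k = real_of_ereal (N k)" for k
  \<comment> \<open>Any fixed slack, here 1, excludes the value \<infinity>, while
    \<open>low\<close> excludes -\<infinity>; hence \<open>N\<close> is real-valued.\<close>
  obtain K1 where K1: "\<And>k. N k \<le> ereal (real k * (\<mu> + 1) + K1)"
    using growth_leE[OF up, of 1] by auto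
  have N: "N k = ereal (n k)" for k
    using low[of k] K1[of k] unfolding n_def by (cases "N k") auto
  have "sublinear (\<lambda>k. n k - real k * \<mu>)"
    unfolding sublinear_def
  proof (intro allI impI)
    fix \<epsilon> :: real assume \<epsilon>: "\<epsilon> > 0"
    obtain K where K: "\<And>k. N k \<le> ereal (real k * (\<mu> + \<epsilon>) + K)"
      using growth_leE[OF up \<epsilon>] by blast
    obtain L where L: "\<And>k. \<bar>s k - real k * \<mu>\<bar> \<le> \<epsilon> * real k + L"
      using sublinearE[OF s \<epsilon>] by blast
    have "\<bar>n k - real k * \<mu>\<bar> \<le> \<epsilon> * real k + max K L" for k
      using K[of k] L[of k] low[of k] max.cobounded1[of K L] max.cobounded2[of L K] unfolding N
      by (simp add: abs_le_iff algebra_simps) linarith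
    then show "\<exists>K. \<forall>k. \<bar>n k - real k * \<mu>\<bar> \<le> \<epsilon> * real k + K"
      by blast
  qed
  \<comment> \<open>The constant \<open>- \<mu>\<close> turns \<open>k * \<mu>\<close> into
    \<open>(k + 1) * \<mu>\<close>, matching the denominator \<open>Suc k\<close>.\<close>
  from sublinear_tendsto[OF sublinear_add[OF this sublinear_const[of "- \<mu>"]]]
  have "(\<lambda>k. (n k - real k * \<mu> + - \<mu>) / real (Suc k) + \<mu>) \<longlonglongrightarrow> 0 + \<mu>"
    by (intro tendsto_add tendsto_const)
  moreover have "(n k - real k * \<mu> + - \<mu>) / real (Suc k) + \<mu> = n k * (1 / real (Suc k))" for k
    by (simp add: field_simps)
  ultimately show ?thesis
    unfolding N by simp
qed

lemma ereal_real_of_ereal_eq: "x \<noteq> \<infinity> \<Longrightarrow> x \<noteq> -\<infinity> \<Longrightarrow> x = ereal (real_of_ereal x)"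
  by (cases x) auto

text \<open>The upper bound is the growth of a triangular recursion followed by one sublinear factor
  \<open>c\<close>. The lower bound is the weight of a single path that stays at the index
  \<open>p\<close> of the largest diagonal mean through all factors \<open>T\<close>.\<close>

lemma lyapunov_triangular:
  fixes b :: "nat \<Rightarrow> ereal^('r::finite)^'n" and c :: "nat \<Rightarrow> ereal^'n^'r"
    and a :: "nat \<Rightarrow> ereal^'n^'n" and \<mu> :: "'r \<Rightarrow> 'r \<Rightarrow> real"
  defines "T \<equiv> \<lambda>k. c (Suc k) \<otimes>\<^sub>m b (Suc (Suc k))"
  assumes prod: "\<And>k. k \<ge> 1 \<Longrightarrow> a k = b k \<otimes>\<^sub>m c k"
    and b_fin: "\<And>k i j. k \<ge> 1 \<Longrightarrow> b k $ i $ j \<noteq> \<infinity>"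
    and c_fin: "\<And>k i j. k \<ge> 1 \<Longrightarrow> c k $ i $ j \<noteq> \<infinity>"
    and b_supp: "\<And>i j. b 1 $ i $ j = -\<infinity> \<longleftrightarrow> b 2 $ i $ j = -\<infinity>"
    and "wf r" and tri: "\<And>k p q. T k $ p $ q \<noteq> -\<infinity> \<Longrightarrow> p = q \<or> (p, q) \<in> r"
    and T: "\<And>p q. (\<forall>k. T k $ p $ q = -\<infinity>) \<or> ((\<forall>k. T k $ p $ q \<noteq> -\<infinity>) \<and>
      sublinear (\<lambda>n. (\<Sum>i<n. real_of_ereal (T i $ p $ q)) - real n * \<mu> p q))"
    and c: "\<And>q j. (\<forall>k. c (Suc k) $ q $ j = -\<infinity>) \<or> ((\<forall>k. c (Suc k) $ q $ j \<noteq> -\<infinity>) \<and>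
      sublinear (\<lambda>k. real_of_ereal (c (Suc k) $ q $ j)))"
    and p: "T 0 $ p $ p \<noteq> -\<infinity>" and p_max: "\<And>q. T 0 $ q $ q \<noteq> -\<infinity> \<Longrightarrow> \<mu> q q \<le> \<mu> p p"
  shows "(\<lambda>k. mp_powr (mp_norm (mp_prod a k)) (1 / real k)) \<longlonglongrightarrow> ereal (\<mu> p p)"
proof -
  \<comment> \<open>\<open>W k\<close> is the prefix \<open>b 1 T 0 ... T (k-1)\<close>, and
    \<open>W k\<close> times \<open>c (Suc k)\<close> is the product of the first
    \<open>k + 1\<close> matrices.\<close>
  define W where "W = rec_nat (b 1) (\<lambda>k W. W \<otimes>\<^sub>m T k)"
  have W_0: "W 0 = b 1" and W_Suc: "W (Suc k) = W k \<otimes>\<^sub>m T k" for k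
    by (simp_all add: W_def)
  have a_fin: "a 1 $ i $ j \<noteq> \<infinity>" for i j
    using prod[of 1] mp_mult_neq_PInf[of "b 1" "c 1"] b_fin c_fin by simp
  have prod_eq: "mp_prod a (Suc k) = W k \<otimes>\<^sub>m c (Suc k)" for k
    using mp_prod_eq[of a b c k, OF prod a_fin] unfolding W_def T_def by simp
  have T_fin: "T k $ i $ j \<noteq> \<infinity>" for k i j
    unfolding T_def by (rule mp_mult_neq_PInf) (simp_all add: b_fin c_fin)
  have W_fin: "W k $ i $ j \<noteq> \<infinity>" for k i j
  proof (induction k arbitrary: i j)
    case (Suc k)
    show ?case
      unfolding W_Suc by (rule mp_mult_neq_PInf[OF Suc T_fin])
  qed (simp add: W_0 b_fin)
  have T_real: "T k $ i $ j = ereal (real_of_ereal (T k $ i $ j))" if "T k $ i $ j \<noteq> -\<infinity>" for k i j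
    using T_fin that by (rule ereal_real_of_ereal_eq)
  have c_real: "c (Suc k) $ i $ j = ereal (real_of_ereal (c (Suc k) $ i $ j))"
    if "c (Suc k) $ i $ j \<noteq> -\<infinity>" for k i j
    using that c_fin[of "Suc k" i j] by (intro ereal_real_of_ereal_eq) auto
  let ?N = "\<lambda>k. mp_norm (mp_prod a (Suc k))"
  have W_growth: "growth_le (\<lambda>k. W k $ i $ q) (\<mu> p p)" for i q
  proof (rule growth_le_triangular[OF \<open>wf r\<close>, where x = "\<lambda>k q. W k $ i $ q" and t = "\<lambda>k p q. T k $ p $ q"])
    show "W (Suc n) $ i $ q = (SUP p. W n $ i $ p + T n $ p $ q)" for n q
      by (simp add: W_Suc mp_mult_nth)
    show "W n $ i $ p \<noteq> \<infinity>" for n p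
      by (rule W_fin)
    show "p = q \<or> (p, q) \<in> r" if "T n $ p $ q \<noteq> -\<infinity>" for n p q
      using that by (rule tri)
    show "\<exists>w. sublinear w \<and> (\<forall>n. T n $ p $ q \<le> ereal (w n))" for p q
      using T[of p q]
    proof
      assume "\<forall>k. T k $ p $ q = -\<infinity>"
      then show ?thesis
        using sublinear_const[of 0] by (intro exI[of _ "\<lambda>_. 0"]) auto
    next
      assume *: "(\<forall>k. T k $ p $ q \<noteq> -\<infinity>) \<and>
        sublinear (\<lambda>n. (\<Sum>i<n. real_of_ereal (T i $ p $ q)) - real n * \<mu> p q)"
      then have "sublinear (\<lambda>n. real_of_ereal (T n $ p $ q))"
        using sublinear_increment by blast
      moreover have "T n $ p $ q \<le> ereal (real_of_ereal (T n $ p $ q))" for n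
        using T_real[of n p q] * by simp
      ultimately show ?thesis
        by blast
    qed
    show "(\<forall>n. T n $ q $ q = -\<infinity>) \<or> (\<exists>\<nu>\<le>\<mu> p p. \<exists>s. (\<forall>n. T n $ q $ q = ereal (s n)) \<and>
      sublinear (\<lambda>n. (\<Sum>i<n. s i) - real n * \<nu>))" for q
      using T[of q q]
    proof
      assume *: "(\<forall>k. T k $ q $ q \<noteq> -\<infinity>) \<and>
        sublinear (\<lambda>n. (\<Sum>i<n. real_of_ereal (T i $ q $ q)) - real n * \<mu> q q)"
      then have "\<forall>n. T n $ q $ q = ereal (real_of_ereal (T n $ q $ q))"
        using T_real by blast
      then show ?thesis
        using * p_max[of q] by (intro disjI2 exI[of _ "\<mu> q q"] conjI exI[of _ "\<lambda>n. real_of_ereal (T n $ q $ q)"]) auto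
    qed simp
  qed
  have c_growth: "growth_le (\<lambda>k. W k $ i $ q + c (Suc k) $ q $ j) (\<mu> p p)" for i q j
    using c[of q j]
  proof
    assume *: "\<forall>k. c (Suc k) $ q $ j = -\<infinity>"
    show ?thesis
      by (rule growth_le_add[OF W_growth sublinear_const[of 0]]) (simp add: *)
  next
    assume *: "(\<forall>k. c (Suc k) $ q $ j \<noteq> -\<infinity>) \<and> sublinear (\<lambda>k. real_of_ereal (c (Suc k) $ q $ j))"
    show ?thesis
    proof (rule growth_le_add[OF W_growth conjunct2[OF *]])
      show "c (Suc n) $ q $ j \<le> ereal (real_of_ereal (c (Suc n) $ q $ j))" for n
        using c_real[of n q j] * by simp
    qed
  qed
  have up: "growth_le ?N (\<mu> p p)"
    unfolding mp_norm_def prod_eq mp_mult_nth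
    by (intro growth_le_SUP finite_class.finite_UNIV c_growth)
  \<comment> \<open>A finite \<open>T 0 $ p $ p\<close> passes through some \<open>l\<close>. As
    \<open>b 1\<close> and \<open>b 2\<close> have the same support, the path from \<open>l\<close>
    to \<open>p\<close> and back to \<open>l\<close> can be used at both ends of the
    product.\<close>
  obtain l where l: "c 1 $ p $ l \<noteq> -\<infinity>" "b 2 $ l $ p \<noteq> -\<infinity>"
    using p mp_mult_eq_MInf[of "c 1" "b 2" p p] c_fin[of 1] b_fin[of 2]
    by (auto simp: T_def numeral_2_eq_2)
  have T_pp: "\<forall>k. T k $ p $ p \<noteq> -\<infinity>"
    and T_sub: "sublinear (\<lambda>n. (\<Sum>i<n. real_of_ereal (T i $ p $ p)) - real n * \<mu> p p)"
    using T[of p p] p by auto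
  have c_pl: "\<forall>k. c (Suc k) $ p $ l \<noteq> -\<infinity>"
    and c_sub: "sublinear (\<lambda>k. real_of_ereal (c (Suc k) $ p $ l))"
    using c[of p l] l(1) by auto
  define \<beta> where "\<beta> = real_of_ereal (b 1 $ l $ p)"
  have \<beta>: "b 1 $ l $ p = ereal \<beta>"
    using l(2) b_supp[of l p] b_fin[of 1 l p] unfolding \<beta>_def
    by (intro ereal_real_of_ereal_eq) auto
  have W_low: "ereal (\<beta> + (\<Sum>i<k. real_of_ereal (T i $ p $ p))) \<le> W k $ l $ p" for k
  proof (induction k)
    case 0
    show ?case unfolding W_0 \<beta> by simp
  next
    case (Suc k)
    have "ereal (\<beta> + (\<Sum>i<Suc k. real_of_ereal (T i $ p $ p))) =
      ereal (\<beta> + (\<Sum>i<k. real_of_ereal (T i $ p $ p))) + ereal (real_of_ereal (T k $ p $ p))"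
      by (simp add: add.assoc)
    also have "\<dots> = ereal (\<beta> + (\<Sum>i<k. real_of_ereal (T i $ p $ p))) + T k $ p $ p"
      by (simp only: T_real[OF spec[OF T_pp], symmetric])
    also have "\<dots> \<le> W k $ l $ p + T k $ p $ p"
      by (rule add_right_mono[OF Suc])
    also have "\<dots> \<le> W (Suc k) $ l $ p"
      unfolding W_Suc mp_mult_nth by (rule SUP_upper) simp
    finally show ?case .
  qed
  define s where "s k = \<beta> + (\<Sum>i<k. real_of_ereal (T i $ p $ p)) + real_of_ereal (c (Suc k) $ p $ l)" for k
  have low: "ereal (s k) \<le> ?N k" for k
  proof -
    have "ereal (s k) = ereal (\<beta> + (\<Sum>i<k. real_of_ereal (T i $ p $ p))) +
      ereal (real_of_ereal (c (Suc k) $ p $ l))"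
      by (simp add: s_def)
    also have "\<dots> = ereal (\<beta> + (\<Sum>i<k. real_of_ereal (T i $ p $ p))) + c (Suc k) $ p $ l"
      by (simp only: c_real[OF spec[OF c_pl], symmetric])
    also have "\<dots> \<le> W k $ l $ p + c (Suc k) $ p $ l"
      by (rule add_right_mono[OF W_low])
    also have "\<dots> \<le> mp_prod a (Suc k) $ l $ l"
      unfolding prod_eq mp_mult_nth by (rule SUP_upper) simp
    also have "\<dots> \<le> ?N k"
      unfolding mp_norm_def by (rule SUP_upper2[of l], simp, rule SUP_upper, simp)
    finally show ?thesis .
  qed
  have "sublinear (\<lambda>k. \<beta> + ((\<Sum>i<k. real_of_ereal (T i $ p $ p)) - real k * \<mu> p p) +
    real_of_ereal (c (Suc k) $ p $ l))"
    by (intro sublinear_add sublinear_const T_sub c_sub)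
  then have "sublinear (\<lambda>k. s k - real k * \<mu> p p)"
    by (simp add: s_def algebra_simps)
  from growth_limit[OF up low this]
  have "(\<lambda>k. mp_powr (?N k) (1 / real (Suc k))) \<longlonglongrightarrow> ereal (\<mu> p p)"
    by (simp only: mp_powr_def)
  \<comment> \<open>Convergence along \<open>Suc k\<close> is convergence along \<open>k\<close>;
    the term at 0, with its division by zero, is irrelevant to the limit.\<close>
  then show ?thesis
    by (rule filterlim_sequentially_Suc[THEN iffD1])
qed

section \<open>Random max-plus matrices\<close>

lemma mp_random_variable_neq_PInf:
  "mp_random_variable M X \<Longrightarrow> \<omega> \<in> space M \<Longrightarrow> X \<omega> \<noteq> \<infinity>"
  by (auto simp: mp_random_variable_def)

text \<open>The definition chooses between -\<infinity> and finite values for the whole sample space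
  at once.\<close>

lemma mp_random_variable_eq_MInf:
  assumes "mp_random_variable M X" and \<omega>: "\<omega> \<in> space M" "\<omega>' \<in> space M"
  shows "X \<omega> = -\<infinity> \<longleftrightarrow> X \<omega>' = -\<infinity>"
  using assms(1) unfolding mp_random_variable_def
proof
  assume "\<forall>\<omega>\<in>space M. X \<omega> = -\<infinity>"
  then show ?thesis
    using \<omega> by simp
next
  assume "(\<forall>\<omega>\<in>space M. \<bar>X \<omega>\<bar> \<noteq> \<infinity>) \<and> integrable M (\<lambda>\<omega>. real_of_ereal (X \<omega>))"
  then have "\<bar>X \<omega>\<bar> \<noteq> \<infinity>" "\<bar>X \<omega>'\<bar> \<noteq> \<infinity>"
    using \<omega> by auto
  then show ?thesis
    by auto
qed

lemma mp_random_variable_integrable: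
  assumes "mp_random_variable M X"
  shows "integrable M (\<lambda>\<omega>. real_of_ereal (X \<omega>))"
proof (cases "\<forall>\<omega>\<in>space M. X \<omega> = -\<infinity>")
  case True
  \<comment> \<open>\<open>real_of_ereal\<close> sends -\<infinity> to 0.\<close>
  then have "integrable M (\<lambda>\<omega>. real_of_ereal (X \<omega>)) \<longleftrightarrow> integrable M (\<lambda>_. 0 :: real)"
    by (intro Bochner_Integration.integrable_cong) auto
  then show ?thesis by simp
next
  case False
  then show ?thesis
    using assms unfolding mp_random_variable_def by blast
qed

lemma mp_random_variable_add:
  assumes X: "mp_random_variable M X" and Y: "mp_random_variable M Y"
  shows "mp_random_variable M (\<lambda>\<omega>. X \<omega> + Y \<omega>)"
proof (cases "(\<forall>\<omega>\<in>space M. X \<omega> = -\<infinity>) \<or> (\<forall>\<omega>\<in>space M. Y \<omega> = -\<infinity>)")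
  case True
  then have "\<forall>\<omega>\<in>space M. X \<omega> + Y \<omega> = -\<infinity>"
    using mp_random_variable_neq_PInf[OF X] mp_random_variable_neq_PInf[OF Y]
    by (auto simp: ereal_plus_eq_MInfty)
  then show ?thesis
    by (simp add: mp_random_variable_def)
next
  case False
  then have fin: "\<forall>\<omega>\<in>space M. \<bar>X \<omega>\<bar> \<noteq> \<infinity>" "\<forall>\<omega>\<in>space M. \<bar>Y \<omega>\<bar> \<noteq> \<infinity>"
    using X Y unfolding mp_random_variable_def by auto
  have fin': "\<forall>\<omega>\<in>space M. \<bar>X \<omega> + Y \<omega>\<bar> \<noteq> \<infinity>"
  proof
    fix \<omega> assume "\<omega> \<in> space M"
    then show "\<bar>X \<omega> + Y \<omega>\<bar> \<noteq> \<infinity>"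
      using fin by (cases "X \<omega>"; cases "Y \<omega>") auto
  qed
  have "integrable M (\<lambda>\<omega>. real_of_ereal (X \<omega>) + real_of_ereal (Y \<omega>))"
    using X Y by (intro Bochner_Integration.integrable_add mp_random_variable_integrable)
  also have "?this \<longleftrightarrow> integrable M (\<lambda>\<omega>. real_of_ereal (X \<omega> + Y \<omega>))"
    using fin by (intro Bochner_Integration.integrable_cong refl) (auto simp: real_of_ereal_add)
  finally show ?thesis
    using fin' unfolding mp_random_variable_def by blast
qed

lemma mp_random_variable_sup:
  assumes X: "mp_random_variable M X" and Y: "mp_random_variable M Y"
  shows "mp_random_variable M (\<lambda>\<omega>. sup (X \<omega>) (Y \<omega>))"
proof -
  consider "\<forall>\<omega>\<in>space M. X \<omega> = -\<infinity>" | "\<forall>\<omega>\<in>space M. Y \<omega> = -\<infinity>" |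
    (fin) "\<forall>\<omega>\<in>space M. \<bar>X \<omega>\<bar> \<noteq> \<infinity>" "\<forall>\<omega>\<in>space M. \<bar>Y \<omega>\<bar> \<noteq> \<infinity>"
    using X Y unfolding mp_random_variable_def by fast
  then show ?thesis
  proof cases
    case 1
    then have "\<forall>\<omega>\<in>space M. sup (X \<omega>) (Y \<omega>) = Y \<omega>"
      by (auto simp: sup_max)
    then show ?thesis
      using Y unfolding mp_random_variable_def
      by (simp cong: Bochner_Integration.integrable_cong)
  next
    case 2
    then have "\<forall>\<omega>\<in>space M. sup (X \<omega>) (Y \<omega>) = X \<omega>"
      by (auto simp: sup_max)
    then show ?thesis
      using X unfolding mp_random_variable_def
      by (simp cong: Bochner_Integration.integrable_cong)
  next
    case fin
    have "integrable M (\<lambda>\<omega>. max (real_of_ereal (X \<omega>)) (real_of_ereal (Y \<omega>)))"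
      using X Y by (intro integrable_max mp_random_variable_integrable)
    also have "?this \<longleftrightarrow> integrable M (\<lambda>\<omega>. real_of_ereal (sup (X \<omega>) (Y \<omega>)))"
    proof (intro Bochner_Integration.integrable_cong refl)
      fix \<omega> assume "\<omega> \<in> space M"
      then show "max (real_of_ereal (X \<omega>)) (real_of_ereal (Y \<omega>)) = real_of_ereal (sup (X \<omega>) (Y \<omega>))"
        using fin by (cases "X \<omega>"; cases "Y \<omega>") (auto simp: sup_max max_def)
    qed
    finally show ?thesis
      using fin unfolding mp_random_variable_def by (auto simp: sup_max max_def)
  qed
qed

lemma mp_random_variable_SUP:
  assumes "finite I" "\<And>i. i \<in> I \<Longrightarrow> mp_random_variable M (X i)"
  shows "mp_random_variable M (\<lambda>\<omega>. SUP i\<in>I. X i \<omega>)"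
  using assms
proof (induction I rule: finite_induct)
  case empty
  then show ?case by (simp add: mp_random_variable_def bot_ereal_def)
next
  case (insert i I)
  then show ?case
    using mp_random_variable_sup[of M "X i" "\<lambda>\<omega>. SUP i\<in>I. X i \<omega>"] by simp
qed

lemma mp_random_variable_mult:
  assumes "\<And>i l. mp_random_variable M (\<lambda>\<omega>. X \<omega> $ i $ l)" "\<And>l j. mp_random_variable M (\<lambda>\<omega>. Y \<omega> $ l $ j)"
  shows "mp_random_variable M (\<lambda>\<omega>. (X \<omega> \<otimes>\<^sub>m Y \<omega>) $ i $ j)"
  unfolding mp_mult_nth using assms
  by (intro mp_random_variable_SUP mp_random_variable_add) auto

lemma borel_measurable_nth_nth[measurable]:
  "(\<lambda>X :: ereal^'m^'n. X $ i $ j) \<in> borel_measurable borel"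
  by (intro borel_measurable_continuous_onI continuous_on_component continuous_on_id)

lemma borel_measurable_mp_mult[measurable]:
  assumes [measurable]: "X \<in> borel_measurable N" "Y \<in> borel_measurable N"
  shows "(\<lambda>\<omega>. (X \<omega> \<otimes>\<^sub>m Y \<omega>) $ i $ j) \<in> borel_measurable N"
proof -
  have [measurable]: "(\<lambda>\<omega>. X \<omega> $ i $ l) \<in> borel_measurable N" for l
    using measurable_compose[OF assms(1) borel_measurable_nth_nth] .
  have [measurable]: "(\<lambda>\<omega>. Y \<omega> $ l $ j) \<in> borel_measurable N" for l
    using measurable_compose[OF assms(2) borel_measurable_nth_nth] .
  show ?thesis
    unfolding mp_mult_nth by measurable
qed

section \<open>Joint laws of the factors\<close>

text \<open>The product measure is determined by its values on rectangles, and on these independence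
  gives the product of the marginals.\<close>

lemma distr_pair_independent_variables:
  assumes "prob_space M" "independent_variables M N X N' Y"
  shows "distr M (N \<Otimes>\<^sub>M N') (\<lambda>\<omega>. (X \<omega>, Y \<omega>)) = distr M N X \<Otimes>\<^sub>M distr M N' Y"
proof (rule pair_measure_eqI[symmetric])
  interpret prob_space M by fact
  have [measurable]: "X \<in> measurable M N" "Y \<in> measurable M N'"
    and ind: "indep_set {X -` S \<inter> space M |S. S \<in> sets N} {Y -` S \<inter> space M |S. S \<in> sets N'}"
    using assms(2) unfolding independent_variables_def by auto
  show "sigma_finite_measure (distr M N X)" "sigma_finite_measure (distr M N' Y)"
    by (auto intro!: prob_space_imp_sigma_finite prob_space_distr)
  show "sets (distr M N X \<Otimes>\<^sub>M distr M N' Y) = sets (distr M (N \<Otimes>\<^sub>M N') (\<lambda>\<omega>. (X \<omega>, Y \<omega>)))"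
    by (simp cong: sets_pair_measure_cong)
  fix S S' assume "S \<in> sets (distr M N X)" "S' \<in> sets (distr M N' Y)"
  then have S: "S \<in> sets N" "S' \<in> sets N'"
    by auto
  have "prob ((X -` S \<inter> space M) \<inter> (Y -` S' \<inter> space M)) = prob (X -` S \<inter> space M) * prob (Y -` S' \<inter> space M)"
    using S by (intro indep_setD[OF ind]) auto
  moreover have "(\<lambda>\<omega>. (X \<omega>, Y \<omega>)) -` (S \<times> S') \<inter> space M = (X -` S \<inter> space M) \<inter> (Y -` S' \<inter> space M)"
    by auto
  ultimately show "emeasure (distr M N X) S * emeasure (distr M N' Y) S' =
      emeasure (distr M (N \<Otimes>\<^sub>M N') (\<lambda>\<omega>. (X \<omega>, Y \<omega>))) (S \<times> S')"
    using S by (simp add: emeasure_distr emeasure_eq_measure ennreal_mult)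
qed

text \<open>Independence of the pairs \<open>i\<close> and \<open>j\<close> is applied to rectangles
  that leave the second component of pair \<open>i\<close> and the first component of pair
  \<open>j\<close> unrestricted.\<close>

lemma iid_pairs_cross_independent:
  assumes "prob_space M" and iid: "iid_sequence M (N \<Otimes>\<^sub>M N') (\<lambda>k \<omega>. (X k \<omega>, Y k \<omega>))"
    and ij: "i \<ge> 1" "j \<ge> 1" "i \<noteq> j"
  shows "independent_variables M N (X i) N' (Y j)"
proof -
  interpret prob_space M by fact
  have ind: "indep_vars (\<lambda>_. N \<Otimes>\<^sub>M N') (\<lambda>k \<omega>. (X k \<omega>, Y k \<omega>)) {1..}"
    using iid unfolding iid_sequence_def by blast
  have Z: "(\<lambda>\<omega>. (X k \<omega>, Y k \<omega>)) \<in> measurable M (N \<Otimes>\<^sub>M N')" if "k \<ge> 1" for k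
    using ind that unfolding indep_vars_def2 by auto
  have X: "X k \<in> measurable M N" and Y: "Y k \<in> measurable M N'" if "k \<ge> 1" for k
    using measurable_compose[OF Z[OF that] measurable_fst]
      measurable_compose[OF Z[OF that] measurable_snd] by auto
  have "indep_set {X i -` S \<inter> space M |S. S \<in> sets N} {Y j -` S \<inter> space M |S. S \<in> sets N'}"
  proof (rule indep_setI)
    fix E F assume "E \<in> {X i -` S \<inter> space M |S. S \<in> sets N}" "F \<in> {Y j -` S \<inter> space M |S. S \<in> sets N'}"
    then obtain S S' where S: "S \<in> sets N" "E = X i -` S \<inter> space M" and S': "S' \<in> sets N'" "F = Y j -` S' \<inter> space M"
      by blast
    let ?A = "\<lambda>k. if k = i then S \<times> space N' else space N \<times> S'"
    have "prob (\<Inter>k\<in>{i, j}. (\<lambda>\<omega>. (X k \<omega>, Y k \<omega>)) -` ?A k \<inter> space M) =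
      (\<Prod>k\<in>{i, j}. prob ((\<lambda>\<omega>. (X k \<omega>, Y k \<omega>)) -` ?A k \<inter> space M))"
      using ij S(1) S'(1) by (intro indep_varsD[OF ind]) auto
    moreover have "(\<lambda>\<omega>. (X i \<omega>, Y i \<omega>)) -` ?A i \<inter> space M = E"
      using measurable_space[OF Y[OF ij(1)]] S(2) by auto
    moreover have "(\<lambda>\<omega>. (X j \<omega>, Y j \<omega>)) -` ?A j \<inter> space M = F"
      using measurable_space[OF X[OF ij(2)]] S'(2) ij(3) by auto
    ultimately show "prob (E \<inter> F) = prob E * prob F"
      using ij(3) by simp
  qed (use X Y ij in auto)
  then show ?thesis
    unfolding independent_variables_def using X Y ij by blast
qed

text \<open>Both sides are products of the same marginal laws: on the left by independence of
  different pairs, on the right by independence within the first pair.\<close>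

lemma iid_pairs_distr_cross:
  assumes "prob_space M" and iid: "iid_sequence M (N \<Otimes>\<^sub>M N') (\<lambda>k \<omega>. (X k \<omega>, Y k \<omega>))"
    and ind: "independent_variables M N (X 1) N' (Y 1)"
  shows "distr M (N \<Otimes>\<^sub>M N') (\<lambda>\<omega>. (X 2 \<omega>, Y 1 \<omega>)) = distr M (N \<Otimes>\<^sub>M N') (\<lambda>\<omega>. (X 1 \<omega>, Y 1 \<omega>))"
proof -
  interpret prob_space M by fact
  have Z: "(\<lambda>\<omega>. (X k \<omega>, Y k \<omega>)) \<in> measurable M (N \<Otimes>\<^sub>M N')" if "k \<ge> 1" for k
    using iid that unfolding iid_sequence_def indep_vars_def2 by auto
  have X: "distr M N (X k) = distr (distr M (N \<Otimes>\<^sub>M N') (\<lambda>\<omega>. (X k \<omega>, Y k \<omega>))) N fst" if "k \<ge> 1" for k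
    by (subst distr_distr[OF measurable_fst Z[OF that]]) (simp add: comp_def)
  have "distr M (N \<Otimes>\<^sub>M N') (\<lambda>\<omega>. (X 2 \<omega>, Y 2 \<omega>)) = distr M (N \<Otimes>\<^sub>M N') (\<lambda>\<omega>. (X 1 \<omega>, Y 1 \<omega>))"
    using iid[unfolded iid_sequence_def, THEN conjunct2, rule_format, of 2] by simp
  then have "distr M N (X 2) = distr M N (X 1)"
    using X[of 1] X[of 2] by simp
  then show ?thesis
    using distr_pair_independent_variables[OF assms(1) ind]
      distr_pair_independent_variables[OF assms(1) iid_pairs_cross_independent[OF assms(1) iid, of 2 1]]
    by simp
qed

lemma mp_random_matrix_sequence_support:
  assumes "mp_random_matrix_sequence M X" "k \<ge> 1" "l \<ge> 1" "\<omega> \<in> space M" "\<omega>' \<in> space M"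
  shows "X k \<omega> $ i $ j = -\<infinity> \<longleftrightarrow> X l \<omega>' $ i $ j = -\<infinity>"
proof -
  have "X k \<omega> $ i $ j = -\<infinity> \<longleftrightarrow> X l \<omega> $ i $ j = -\<infinity>"
    using assms unfolding mp_random_matrix_sequence_def by blast
  also have "\<dots> \<longleftrightarrow> X l \<omega>' $ i $ j = -\<infinity>"
  proof (rule mp_random_variable_eq_MInf[where X = "\<lambda>\<omega>. X l \<omega> $ i $ j"])
    show "mp_random_variable M (\<lambda>\<omega>. X l \<omega> $ i $ j)"
      using assms(1,3) unfolding mp_random_matrix_sequence_def mp_random_matrix_def by blast
  qed fact+
  finally show ?thesis .
qed

lemma mp_expectation_eq:
  assumes "mp_random_variable M X" "\<omega> \<in> space M"
  shows "mp_expectation M X = (if X \<omega> = -\<infinity> then -\<infinity> else ereal (\<integral>\<omega>. real_of_ereal (X \<omega>) \<partial>M))"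
proof -
  have "(\<forall>\<omega>\<in>space M. X \<omega> = -\<infinity>) \<longleftrightarrow> X \<omega> = -\<infinity>"
    using mp_random_variable_eq_MInf[OF assms] assms(2) by blast
  then show ?thesis
    unfolding mp_expectation_def by (simp only:)
qed

theorem theorem5:
  fixes M :: "'a measure"
    and A :: "nat \<Rightarrow> 'a \<Rightarrow> ereal^'n^'n"
    and B :: "nat \<Rightarrow> 'a \<Rightarrow> ereal^('r::{finite,linorder})^'n"
    and C :: "nat \<Rightarrow> 'a \<Rightarrow> ereal^'n^('r::{finite,linorder})"
  assumes "prob_space M"
    and "mp_random_matrix_sequence M A"
    and "mp_random_matrix_sequence M B"
    and "mp_random_matrix_sequence M C"
    and "iid_sequence M borel A"
    and "integrable M (\<lambda>\<omega>. real_of_ereal (mp_norm (A 1 \<omega>)))"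
    and "mp_spectral_radius (mp_expectation_matrix M (A 1)) > -\<infinity>"
    and "\<And>k. k \<ge> 1 \<Longrightarrow> AE \<omega> in M. mp_skeleton_decomposition (A k \<omega>) (B k \<omega>) (C k \<omega>)"
    and "\<And>k. k \<ge> 1 \<Longrightarrow> AE \<omega> in M. mp_backward_triangular (B k \<omega>) (C k \<omega>)"
    and "\<And>k. k \<ge> 1 \<Longrightarrow> independent_variables M borel (B k) borel (C k)"
    and "iid_sequence M (borel \<Otimes>\<^sub>M borel) (\<lambda>k \<omega>. (B k \<omega>, C k \<omega>))"
  shows "\<exists>l. has_lyapunov_exponent M A l \<and>
    ereal l = mp_trace (mp_expectation_matrix M (\<lambda>\<omega>. C 1 \<omega> \<otimes>\<^sub>m B 1 \<omega>))"
proof -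
  note iid = assms(11)
  interpret prob_space M by fact
  have A_rv: "mp_random_variable M (\<lambda>\<omega>. A 1 \<omega> $ i $ j)" for i j
    using assms(2) unfolding mp_random_matrix_sequence_def mp_random_matrix_def by blast
  have B_rv: "mp_random_variable M (\<lambda>\<omega>. B k \<omega> $ i $ j)" if "k \<ge> 1" for k i j
    using assms(3) that unfolding mp_random_matrix_sequence_def mp_random_matrix_def by blast
  have C_rv: "mp_random_variable M (\<lambda>\<omega>. C k \<omega> $ i $ j)" if "k \<ge> 1" for k i j
    using assms(4) that unfolding mp_random_matrix_sequence_def mp_random_matrix_def by blast
  have B_meas: "B k \<in> borel_measurable M" if "k \<ge> 1" for k
    using assms(3) that unfolding mp_random_matrix_sequence_def mp_random_matrix_def by blast
  have C_meas: "C k \<in> borel_measurable M" if "k \<ge> 1" for k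
    using assms(4) that unfolding mp_random_matrix_sequence_def mp_random_matrix_def by blast
  have B_fin: "B k \<omega> $ i $ j \<noteq> \<infinity>" if "k \<ge> 1" "\<omega> \<in> space M" for k \<omega> i j
    using mp_random_variable_neq_PInf[OF B_rv[OF that(1)] that(2)] .
  have C_fin: "C k \<omega> $ i $ j \<noteq> \<infinity>" if "k \<ge> 1" "\<omega> \<in> space M" for k \<omega> i j
    using mp_random_variable_neq_PInf[OF C_rv[OF that(1)] that(2)] .
  note B_supp = mp_random_matrix_sequence_support[OF assms(3)]
  note C_supp = mp_random_matrix_sequence_support[OF assms(4)]

  \<comment> \<open>One outcome \<open>\<omega>0\<close> is fixed at which the factorization and
    triangularity hold for \<open>k = 1\<close>. Supports do not depend on the outcome, so support
    properties seen there hold everywhere.\<close>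
  have "AE \<omega> in M. mp_skeleton_decomposition (A 1 \<omega>) (B 1 \<omega>) (C 1 \<omega>) \<and>
    mp_backward_triangular (B 1 \<omega>) (C 1 \<omega>) \<and> \<omega> \<in> space M"
    using assms(8)[of 1] assms(9)[of 1] by auto
  then obtain \<omega>0 where \<omega>0: "\<omega>0 \<in> space M"
    and skel: "mp_skeleton_decomposition (A 1 \<omega>0) (B 1 \<omega>0) (C 1 \<omega>0)"
    and backward: "mp_backward_triangular (B 1 \<omega>0) (C 1 \<omega>0)"
    using eventually_happens'[OF ae_filter_bot] by blast
  define F where "F = support_rel (C 1 \<omega>0 \<otimes>\<^sub>m B 1 \<omega>0)"
  \<comment> \<open>The graph of a product depends only on the graphs of its factors, so
    \<open>F\<close> is the graph of \<open>C k\<close> times \<open>B l\<close> for all indices and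
    outcomes.\<close>
  have F_eq: "(p, q) \<in> F \<longleftrightarrow> (C k \<omega> \<otimes>\<^sub>m B l \<omega>) $ p $ q \<noteq> -\<infinity>"
    if "k \<ge> 1" "l \<ge> 1" "\<omega> \<in> space M" for k l \<omega> p q
  proof -
    have "(C k \<omega> \<otimes>\<^sub>m B l \<omega>) $ p $ q = -\<infinity> \<longleftrightarrow> (C 1 \<omega>0 \<otimes>\<^sub>m B 1 \<omega>0) $ p $ q = -\<infinity>"
      using that \<omega>0 by (simp add: mp_mult_eq_MInf B_fin C_fin
          B_supp[OF that(2) order_refl that(3) \<omega>0] C_supp[OF that(1) order_refl that(3) \<omega>0])
    then show ?thesis
      by (simp add: F_def support_rel_def)
  qed
  \<comment> \<open>The strict order is \<open>>\<close> or \<open><\<close> according to which side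
    of the diagonal vanishes.\<close>
  have "\<exists>r. trans r \<and> irrefl r \<and> (\<forall>p q. (p, q) \<in> F \<longrightarrow> p = q \<or> (p, q) \<in> r)"
    using backward unfolding mp_backward_triangular_def mp_triangular_def
  proof
    assume "\<forall>i j. i < j \<longrightarrow> (C 1 \<omega>0 \<otimes>\<^sub>m B 1 \<omega>0) $ i $ j = -\<infinity>"
    then show ?thesis
      unfolding F_def support_rel_def
      by (intro exI[of _ "{(p, q). q < p}"]) (auto simp: trans_def irrefl_def not_less_iff_gr_or_eq)
  next
    assume "\<forall>i j. j < i \<longrightarrow> (C 1 \<omega>0 \<otimes>\<^sub>m B 1 \<omega>0) $ i $ j = -\<infinity>"
    then show ?thesis
      unfolding F_def support_rel_def
      by (intro exI[of _ "{(p, q). p < q}"]) (auto simp: trans_def irrefl_def not_less_iff_gr_or_eq)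
  qed
  then obtain r where r: "trans r" "irrefl r" "\<And>p q. (p, q) \<in> F \<Longrightarrow> p = q \<or> (p, q) \<in> r"
    by blast
  then have "wf r"
    by (intro finite_acyclic_wf) (auto simp: acyclic_irrefl)

  have "\<exists>p. (p, p) \<in> F"
  proof -
    let ?E = "mp_expectation_matrix M (A 1)"
    have E: "?E $ i $ j = (if A 1 \<omega>0 $ i $ j = -\<infinity> then -\<infinity>
      else ereal (\<integral>\<omega>. real_of_ereal (A 1 \<omega> $ i $ j) \<partial>M))" for i j
      using mp_expectation_eq[OF A_rv \<omega>0] by (simp add: mp_expectation_matrix_def)
    then have "?E $ i $ j \<noteq> \<infinity>" for i j
      by simp
    then obtain i where "(i, i) \<in> (support_rel ?E)\<^sup>+"
      using spectral_radius_cycle[of ?E] assms(7) by blast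
    \<comment> \<open>An expectation is -\<infinity> only for an entry that is identically
      -\<infinity>.\<close>
    also have "support_rel ?E = support_rel (A 1 \<omega>0)"
      unfolding support_rel_def E by auto
    also have "\<dots> = support_rel (B 1 \<omega>0) O support_rel (C 1 \<omega>0)"
      using skel unfolding mp_skeleton_decomposition_def
      by (simp add: support_rel_mult B_fin C_fin \<omega>0)
    finally obtain l where "(l, l) \<in> (support_rel (C 1 \<omega>0) O support_rel (B 1 \<omega>0))\<^sup>+"
      by (rule exE[OF cycle_relcomp_swap])
    then have "(l, l) \<in> F\<^sup>+"
      unfolding F_def by (simp add: support_rel_mult B_fin C_fin \<omega>0)
    then show ?thesis
      by (rule triangular_cycle[OF _ r])
  qed
  define \<mu> where "\<mu> p q = (\<integral>\<omega>. real_of_ereal ((C 1 \<omega> \<otimes>\<^sub>m B 1 \<omega>) $ p $ q) \<partial>M)" for p q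
  \<comment> \<open>Off \<open>F\<close> the integral \<open>\<mu> q q\<close> has the default value
    0 instead of -\<infinity>, so the maximum is taken over loops of \<open>F\<close> only.\<close>
  obtain p where p: "(p, p) \<in> F" "\<And>q. (q, q) \<in> F \<Longrightarrow> \<mu> q q \<le> \<mu> p p"
  proof -
    let ?S = "(\<lambda>p. \<mu> p p) ` {p. (p, p) \<in> F}"
    have "Max ?S \<in> ?S"
      using \<open>\<exists>p. (p, p) \<in> F\<close> by (intro Max_in) auto
    then obtain p where "(p, p) \<in> F" "Max ?S = \<mu> p p"
      by blast
    moreover have "\<mu> q q \<le> Max ?S" if "(q, q) \<in> F" for q
      using that by (intro Max_ge) auto
    ultimately show ?thesis
      using that by simp
  qed

  have trace: "ereal (\<mu> p p) = mp_trace (mp_expectation_matrix M (\<lambda>\<omega>. C 1 \<omega> \<otimes>\<^sub>m B 1 \<omega>))"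
  proof -
    have E: "mp_expectation_matrix M (\<lambda>\<omega>. C 1 \<omega> \<otimes>\<^sub>m B 1 \<omega>) $ q $ q =
      (if (q, q) \<in> F then ereal (\<mu> q q) else -\<infinity>)" for q
    proof -
      have "mp_random_variable M (\<lambda>\<omega>. (C 1 \<omega> \<otimes>\<^sub>m B 1 \<omega>) $ q $ q)"
        by (intro mp_random_variable_mult B_rv C_rv order_refl)
      from mp_expectation_eq[OF this \<omega>0] show ?thesis
        using F_eq[OF order_refl order_refl \<omega>0] by (simp add: mp_expectation_matrix_def \<mu>_def)
    qed
    show ?thesis
      unfolding mp_trace_def E
    proof (rule antisym)
      show "ereal (\<mu> p p) \<le> (SUP q. if (q, q) \<in> F then ereal (\<mu> q q) else -\<infinity>)"
        using p(1) by (intro SUP_upper2[of p]) auto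
      show "(SUP q. if (q, q) \<in> F then ereal (\<mu> q q) else -\<infinity>) \<le> ereal (\<mu> p p)"
        using p(2) by (intro SUP_least) auto
    qed
  qed

  \<comment> \<open>The last factor of the product contributes a single term, which is o(k) as an
    increment of partial sums obeying the law of large numbers.\<close>
  have C_sub: "AE \<omega> in M. sublinear (\<lambda>k. real_of_ereal (C (Suc k) \<omega> $ q $ j))" for q j
  proof -
    define f where "f z = real_of_ereal (snd (z 0) $ q $ j)"
      for z :: "nat \<Rightarrow> (ereal^('r::{finite,linorder})^'n) \<times> (ereal^'n^('r::{finite,linorder}))"
    have f: "f \<in> borel_measurable (PiM UNIV (\<lambda>_. borel \<Otimes>\<^sub>M borel))"
      unfolding f_def
      by (rule borel_measurable_real_of_ereal, rule measurable_compose[OF _ borel_measurable_nth_nth],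
          rule measurable_compose[OF _ measurable_snd], rule measurable_component_singleton) simp
    have "integrable M (\<lambda>\<omega>. f (\<lambda>j. (B (Suc j) \<omega>, C (Suc j) \<omega>)))"
      unfolding f_def using mp_random_variable_integrable[OF C_rv[of 1]] by simp
    from iid_sequence_law_of_large_numbers[OF assms(1) iid f this]
    show ?thesis
      by eventually_elim (drule sublinear_increment, simp add: f_def)
  qed
  have T_sub: "AE \<omega> in M. sublinear (\<lambda>n. (\<Sum>i<n. real_of_ereal
    ((C (Suc i) \<omega> \<otimes>\<^sub>m B (Suc (Suc i)) \<omega>) $ q $ q')) - real n * \<mu> q q')" for q q'
  proof -
    \<comment> \<open>The coordinates 0 and 1 of \<open>z\<close> stand for the pairs with indices 1
      and 2.\<close>
    define f where "f z = real_of_ereal ((snd (z 0) \<otimes>\<^sub>m fst (z 1)) $ q $ q')"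
      for z :: "nat \<Rightarrow> (ereal^('r::{finite,linorder})^'n) \<times> (ereal^'n^('r::{finite,linorder}))"
    have f: "f \<in> borel_measurable (PiM UNIV (\<lambda>_. borel \<Otimes>\<^sub>M borel))"
      unfolding f_def
      by (rule borel_measurable_real_of_ereal, rule borel_measurable_mp_mult,
          rule measurable_compose[OF _ measurable_snd], rule measurable_component_singleton, simp,
          rule measurable_compose[OF _ measurable_fst], rule measurable_component_singleton, simp)
    have int: "integrable M (\<lambda>\<omega>. f (\<lambda>j. (B (Suc j) \<omega>, C (Suc j) \<omega>)))"
      unfolding f_def fst_conv snd_conv
      by (intro mp_random_variable_integrable mp_random_variable_mult B_rv C_rv) auto
    define h where "h z = real_of_ereal ((snd z \<otimes>\<^sub>m fst z) $ q $ q')"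
      for z :: "(ereal^('r::{finite,linorder})^'n) \<times> (ereal^'n^('r::{finite,linorder}))"
    have h: "h \<in> borel_measurable (borel \<Otimes>\<^sub>M borel)"
      unfolding h_def
      by (rule borel_measurable_real_of_ereal, rule borel_measurable_mp_mult)
        (rule measurable_snd measurable_fst)+
    have BC: "(\<lambda>\<omega>. (B k \<omega>, C 1 \<omega>)) \<in> measurable M (borel \<Otimes>\<^sub>M borel)" if "k \<ge> 1" for k
      using B_meas[OF that] C_meas[of 1] by (intro measurable_Pair) auto
    \<comment> \<open>The law of large numbers yields the mean of \<open>C 1\<close> times
      \<open>B 2\<close>. Since \<open>(B 2, C 1)\<close> and \<open>(B 1, C 1)\<close> have the
      same joint law, it equals \<open>\<mu> q q'\<close>.\<close>
    have "(\<integral>\<omega>. f (\<lambda>j. (B (Suc j) \<omega>, C (Suc j) \<omega>)) \<partial>M) = (\<integral>\<omega>. h (B 2 \<omega>, C 1 \<omega>) \<partial>M)"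
      by (simp add: f_def h_def numeral_2_eq_2)
    also have "\<dots> = integral\<^sup>L (distr M (borel \<Otimes>\<^sub>M borel) (\<lambda>\<omega>. (B 2 \<omega>, C 1 \<omega>))) h"
      by (rule integral_distr[OF BC h, symmetric]) simp
    also have "\<dots> = integral\<^sup>L (distr M (borel \<Otimes>\<^sub>M borel) (\<lambda>\<omega>. (B 1 \<omega>, C 1 \<omega>))) h"
      by (simp only: iid_pairs_distr_cross[OF assms(1) iid assms(10)[OF order_refl]])
    also have "\<dots> = \<mu> q q'"
      unfolding integral_distr[OF BC[OF order_refl] h] by (simp add: h_def \<mu>_def)
    finally have "(\<integral>\<omega>. f (\<lambda>j. (B (Suc j) \<omega>, C (Suc j) \<omega>)) \<partial>M) = \<mu> q q'" .
    with iid_sequence_law_of_large_numbers[OF assms(1) iid f int] show ?thesis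
      by (simp add: f_def)
  qed
  \<comment> \<open>All index sets are countable, so the exceptional events together form a null
    set.\<close>
  have "AE \<omega> in M. \<forall>q j. sublinear (\<lambda>k. real_of_ereal (C (Suc k) \<omega> $ q $ j))"
    unfolding AE_all_countable using C_sub by blast
  moreover have "AE \<omega> in M. \<forall>q q'. sublinear (\<lambda>n. (\<Sum>i<n. real_of_ereal
    ((C (Suc i) \<omega> \<otimes>\<^sub>m B (Suc (Suc i)) \<omega>) $ q $ q')) - real n * \<mu> q q')"
    unfolding AE_all_countable using T_sub by blast
  moreover have "AE \<omega> in M. \<forall>k\<ge>1. A k \<omega> = B k \<omega> \<otimes>\<^sub>m C k \<omega>"
    unfolding AE_all_countable
  proof
    fix k :: nat
    show "AE \<omega> in M. 1 \<le> k \<longrightarrow> A k \<omega> = B k \<omega> \<otimes>\<^sub>m C k \<omega>"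
    proof (cases "1 \<le> k")
      case True
      show ?thesis
        using assms(8)[OF True] by eventually_elim (simp add: mp_skeleton_decomposition_def)
    qed simp
  qed
  ultimately have "has_lyapunov_exponent M A (\<mu> p p)"
    unfolding has_lyapunov_exponent_def using AE_space
  proof eventually_elim
    case (elim \<omega>)
    show ?case
    proof (rule lyapunov_triangular[where r = r and b = "\<lambda>k. B k \<omega>" and c = "\<lambda>k. C k \<omega>"
          and a = "\<lambda>k. A k \<omega>" and \<mu> = \<mu>])
      show "A k \<omega> = B k \<omega> \<otimes>\<^sub>m C k \<omega>" if "1 \<le> k" for k
        using elim(3) that by blast
      show "B k \<omega> $ i $ j \<noteq> \<infinity>" if "1 \<le> k" for k i j
        using B_fin[OF that elim(4)] .
      show "C k \<omega> $ i $ j \<noteq> \<infinity>" if "1 \<le> k" for k i j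
        using C_fin[OF that elim(4)] .
      show "B 1 \<omega> $ i $ j = -\<infinity> \<longleftrightarrow> B 2 \<omega> $ i $ j = -\<infinity>" for i j
        using elim(4) by (intro B_supp) auto
      show "wf r" by (rule \<open>wf r\<close>)
      have T: "(C (Suc k) \<omega> \<otimes>\<^sub>m B (Suc (Suc k)) \<omega>) $ q $ q' \<noteq> -\<infinity> \<longleftrightarrow> (q, q') \<in> F" for k q q'
        using elim(4) by (intro F_eq[symmetric]) auto
      show "q = q' \<or> (q, q') \<in> r" if "(C (Suc k) \<omega> \<otimes>\<^sub>m B (Suc (Suc k)) \<omega>) $ q $ q' \<noteq> -\<infinity>" for k q q'
        using that unfolding T by (rule r(3))
      show "(\<forall>k. (C (Suc k) \<omega> \<otimes>\<^sub>m B (Suc (Suc k)) \<omega>) $ q $ q' = -\<infinity>) \<or>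
        (\<forall>k. (C (Suc k) \<omega> \<otimes>\<^sub>m B (Suc (Suc k)) \<omega>) $ q $ q' \<noteq> -\<infinity>) \<and>
        sublinear (\<lambda>n. (\<Sum>i<n. real_of_ereal ((C (Suc i) \<omega> \<otimes>\<^sub>m B (Suc (Suc i)) \<omega>) $ q $ q')) -
          real n * \<mu> q q')" for q q'
        using elim(2) T[of _ q q'] by (cases "(q, q') \<in> F") auto
      show "(\<forall>k. C (Suc k) \<omega> $ q $ j = -\<infinity>) \<or> (\<forall>k. C (Suc k) \<omega> $ q $ j \<noteq> -\<infinity>) \<and>
        sublinear (\<lambda>k. real_of_ereal (C (Suc k) \<omega> $ q $ j))" for q j
      proof -
        have "C (Suc k) \<omega> $ q $ j = -\<infinity> \<longleftrightarrow> C 1 \<omega> $ q $ j = -\<infinity>" for k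
          using elim(4) by (intro C_supp) auto
        then show ?thesis
          using elim(1) by (cases "C 1 \<omega> $ q $ j = -\<infinity>") auto
      qed
      show "(C (Suc 0) \<omega> \<otimes>\<^sub>m B (Suc (Suc 0)) \<omega>) $ p $ p \<noteq> -\<infinity>"
        unfolding T by (rule p(1))
      show "\<mu> q q \<le> \<mu> p p" if "(C (Suc 0) \<omega> \<otimes>\<^sub>m B (Suc (Suc 0)) \<omega>) $ q $ q \<noteq> -\<infinity>" for q
        using that unfolding T by (rule p(2))
    qed
  qed
  with trace show ?thesis
    by blast
qed

end
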